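(* Let $\mathcal{Y}\subset\mathbb{R}^m$ be compact, let $\nu$ be a Borel measure on $\mathbb{R}^m$ with $\mathrm{supp}(\nu)=\mathcal{Y}$ and $\int_{\mathcal{Y}}|h|\,\mathrm{d}\nu<\infty$ for all $h\in\mathbb{R}[\boldsymbol{y}]$, let $f\in\mathbb{R}[\boldsymbol{x}]$, $G_j\in\mathbb{S}[\boldsymbol{x},\boldsymbol{y}]^{q_j}$ for $j=1,\ldots,s$, and $$\widehat{\mathcal{X}}=\{\boldsymbol{x}\in\mathbb{R}^n\mid G_j(\boldsymbol{x},\boldsymbol{y})\succeq 0,\ \forall j\in\{1,\ldots,s\},\ \forall\boldsymbol{y}\in\mathcal{Y}\}.$$ Let $\mathcal{I}_1,\ldots,\mathcal{I}_t\subseteq\{1,\ldots,n\}$ with $\bigcup_\ell\mathcal{I}_\ell=\{1,\ldots,n\}$ and $\mathcal{J}_1,\ldots,\mathcal{J}_t\subseteq\{1,\ldots,s\}$ with $\bigcup_\ell\mathcal{J}_\ell=\{1,\ldots,s\}$ satisfy: (i) (running intersection property) for every $\ell=2,\ldots,t$ there is $k<\ell$ with $\mathcal{I}_\ell\cap\bigcup_{j<\ell}\mathcal{I}_j\subseteq\mathcal{I}_k$; (ii) for every $\ell\in\{1,\ldots,t\}$ and $j\in\mathcal{J}_\ell$, $G_j\in\mathbb{S}[\boldsymbol{x}(\mathcal{I}_\ell),\boldsymbol{y}]^{q_j}$; (iii) $f=f_1+\cdots+f_t$ with $f_\ell\in\mathbb{R}[\boldsymbol{x}(\mathcal{I}_\ell)]$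 for each $\ell$. Suppose also that for each $\ell\in\{1,\ldots,t\}$ there is $C_\ell>0$ with $C_\ell-\Vert\boldsymbol{x}(\mathcal{I}_\ell)\Vert^2\in\mathcal{Q}^1(\mathbf{G}^\ell,\nu)$. If $f>0$ on $\widehat{\mathcal{X}}$, then $f\in\sum_{\ell=1}^t\mathcal{Q}^1(\mathbf{G}^\ell,\nu)$; that is, there exist SOS polynomials $\sigma_{\ell,0}\in\mathbb{R}[\boldsymbol{x}(\mathcal{I}_\ell)]$ and SOS matrices $S_{\ell,j}\in\mathbb{S}[\boldsymbol{x}(\mathcal{I}_\ell),\boldsymbol{y}]^{q_j}$ ($j\in\mathcal{J}_\ell$, $\ell=1,\ldots,t$) such that $$f(\boldsymbol{x})=\sum_{\ell=1}^t\left(\sigma_{\ell,0}(\boldsymbol{x}(\mathcal{I}_\ell))+\sum_{j\in\mathcal{J}_\ell}\int_{\mathcal{Y}}\langle S_{\ell,j}(\boldsymbol{x}(\mathcal{I}_\ell),\boldsymbol{y}),G_j(\boldsymbol{x}(\mathcal{I}_\ell),\boldsymbol{y})\rangle\,\mathrm{d}\nu(\boldsymbol{y})\right).$$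
   Context: $\boldsymbol{x}=(x_1,\ldots,x_n)$, $\boldsymbol{y}=(y_1,\ldots,y_m)$. For $\mathcal{I}\subseteq\{1,\ldots,n\}$, $\boldsymbol{x}(\mathcal{I})=(x_i)_{i\in\mathcal{I}}$. $\mathbb{S}[\cdot]^q$ denotes $q\times q$ symmetric matrices with real polynomial entries in the indicated variables. An SOS matrix of size $r\times r$ is one of the form $T^{\intercal}T$ with $T$ an $l\times r$ real polynomial matrix in the same variables, $l\in\mathbb{N}$; an SOS polynomial is the case $r=1$. $\langle A,B\rangle=\mathrm{tr}(A^{\intercal}B)$. For a polynomial $h(\boldsymbol{x},\boldsymbol{y})=\sum_\beta h_\beta(\boldsymbol{x})\boldsymbol{y}^\beta$, $\int_{\mathcal{Y}}h\,\mathrm{d}\nu(\boldsymbol{y})=\sum_\beta h_\beta(\boldsymbol{x})\int_{\mathcal{Y}}\boldsymbol{y}^\beta\,\mathrm{d}\nu(\boldsymbol{y})$. For each $\ell$, $\mathbf{G}^\ell=\{G_j\}_{j\in\mathcal{J}_\ell}$ and $$\mathcal{Q}^1(\mathbf{G}^\ell,\nu)=\left\{\sigma_0+\sum_{j\in\mathcal{J}_\ell}\int_{\mathcal{Y}}\langle S_j,G_j\rangle\,\mathrm{d}\nu(\boldsymbol{y})\ \middle|\ \sigma_0\in\mathbb{R}[\boldsymbol{x}(\mathcal{I}_\ell)]\text{ SOS},\ S_j\in\mathbb{S}[\boldsymbol{x}(\mathcal{I}_\ell),\boldsymbol{y}]^{q_j}\text{ SOS matrices}\right\}.$$ *)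

theory Defs
  imports
    "HOL-Analysis.Analysis"
    "HOL-Library.Poly_Mapping"
    "HOL-Library.Set_Algebras"
    "Jordan_Normal_Form.Matrix"
begin

text \<open>
  The real polynomial ring in variables indexed by \<open>'v\<close> is the monoid algebra of the
  monomials \<open>'v \<Rightarrow>\<^sub>0 nat\<close>; its commutative ring structure is the convolution product of
  \<^theory>\<open>HOL-Library.Poly_Mapping\<close>.  With \<open>'n\<close> and \<open>'m\<close> finite, polynomials in
  \<open>x = (x\<^sub>i)\<close> have type \<open>'n rpoly\<close>, those in \<open>y = (y\<^sub>j)\<close> type \<open>'m rpoly\<close>, and those in
  \<open>(x, y)\<close> type \<open>('n + 'm) rpoly\<close>, where \<open>Inl i\<close> stands for \<open>x\<^sub>i\<close> and \<open>Inr j\<close> for \<open>y\<^sub>j\<close>.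
\<close>

type_synonym 'v rpoly = "('v \<Rightarrow>\<^sub>0 nat) \<Rightarrow>\<^sub>0 real"

definition Var :: "'v \<Rightarrow> 'v rpoly" where
  "Var v = Poly_Mapping.single (Poly_Mapping.single v 1) 1"

definition Const :: "real \<Rightarrow> 'v rpoly" where
  "Const c = Poly_Mapping.single 0 c"

definition eval_monom :: "('v \<Rightarrow> real) \<Rightarrow> ('v \<Rightarrow>\<^sub>0 nat) \<Rightarrow> real" where
  "eval_monom x \<mu> = (\<Prod>v\<in>Poly_Mapping.keys \<mu>. x v ^ Poly_Mapping.lookup \<mu> v)"

definition eval :: "('v \<Rightarrow> real) \<Rightarrow> 'v rpoly \<Rightarrow> real" where
  "eval x p = (\<Sum>\<mu>\<in>Poly_Mapping.keys p. Poly_Mapping.lookup p \<mu> * eval_monom x \<mu>)"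

definition eval_xy :: "real ^ 'n \<Rightarrow> real ^ 'm \<Rightarrow> ('n + 'm) rpoly \<Rightarrow> real" where
  "eval_xy x y = eval (case_sum (vec_nth x) (vec_nth y))"

text \<open>The subring of the polynomials that only involve variables from \<open>V\<close>.\<close>

definition polys_in :: "'v set \<Rightarrow> 'v rpoly set" where
  "polys_in V = {p. \<forall>\<mu>\<in>Poly_Mapping.keys p. Poly_Mapping.keys \<mu> \<subseteq> V}"

text \<open>The variables of the ring \<open>\<real>[x(I), y]\<close>.\<close>

definition vars_xy :: "'n set \<Rightarrow> ('n + 'm) set" where
  "vars_xy I = Inl ` I \<union> range Inr"

definition sym_mats :: "'v set \<Rightarrow> nat \<Rightarrow> 'v rpoly mat set" where
  "sym_mats V q =
     {A \<in> carrier_mat q q. transpose_mat A = A \<and> elements_mat A \<subseteq> polys_in V}"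

definition sos_mats :: "'v set \<Rightarrow> nat \<Rightarrow> 'v rpoly mat set" where
  "sos_mats V r =
     {transpose_mat T * T | T l. T \<in> carrier_mat l r \<and> elements_mat T \<subseteq> polys_in V}"

definition sos_polys :: "'v set \<Rightarrow> 'v rpoly set" where
  "sos_polys V = {\<sigma>. mat 1 1 (\<lambda>_. \<sigma>) \<in> sos_mats V 1}"

definition mat_inner :: "'a::comm_ring_1 mat \<Rightarrow> 'a mat \<Rightarrow> 'a" where
  "mat_inner A B =
     (let M = transpose_mat A * B in \<Sum>i<dim_row M. M $$ (i, i))"

definition psd :: "real mat \<Rightarrow> bool" where
  "psd A \<longleftrightarrow> transpose_mat A = A \<and>
     (\<forall>v\<in>carrier_vec (dim_row A). 0 \<le> scalar_prod v (mult_mat_vec A v))"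

text \<open>
  \<open>coeff_y h \<beta>\<close> is the coefficient \<open>h\<^sub>\<beta>(x)\<close> in \<open>h = (\<Sum>\<beta>. h\<^sub>\<beta>(x) y\<^sup>\<beta>)\<close>.  A monomial \<open>\<mu>\<close> in
  \<open>(x, y)\<close> has the \<open>x\<close>-part \<open>map_key Inl \<mu>\<close> and the \<open>y\<close>-part \<open>map_key Inr \<mu>\<close>.
\<close>

definition coeff_y :: "('n + 'm) rpoly \<Rightarrow> ('m \<Rightarrow>\<^sub>0 nat) \<Rightarrow> 'n rpoly" where
  "coeff_y h \<beta> =
     (\<Sum>\<mu> | \<mu> \<in> Poly_Mapping.keys h \<and> Poly_Mapping.map_key Inr \<mu> = \<beta>.
        Poly_Mapping.single (Poly_Mapping.map_key Inl \<mu>) (Poly_Mapping.lookup h \<mu>))"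

definition integral_y ::
  "(real ^ 'm) set \<Rightarrow> (real ^ 'm) measure \<Rightarrow> ('n + 'm) rpoly \<Rightarrow> 'n rpoly" where
  "integral_y Y \<nu> h =
     (\<Sum>\<beta>\<in>Poly_Mapping.map_key Inr ` Poly_Mapping.keys h.
        coeff_y h \<beta> * Const (set_lebesgue_integral \<nu> Y (\<lambda>y. eval_monom (vec_nth y) \<beta>)))"

definition measure_support :: "'a::topological_space measure \<Rightarrow> 'a set" where
  "measure_support \<nu> = {y. \<forall>U. open U \<longrightarrow> y \<in> U \<longrightarrow> 0 < emeasure \<nu> U}"

definition feasible_set ::
  "nat \<Rightarrow> (nat \<Rightarrow> ('n + 'm) rpoly mat) \<Rightarrow> (real ^ 'm) set \<Rightarrow> (real ^ 'n) set" where
  "feasible_set s G Y = {x. \<forall>j\<in>{1..s}. \<forall>y\<in>Y. psd (map_mat (eval_xy x y) (G j))}"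

text \<open>
  The set \<open>\<Q>\<^sup>1\<close> generated by the family \<open>(G j)\<close>, \<open>j \<in> J\<close>, where \<open>G j\<close> has size
  \<open>q j\<close>, over the variables \<open>x(I)\<close>.
\<close>

definition Q1 ::
  "'n set \<Rightarrow> nat set \<Rightarrow> (nat \<Rightarrow> nat) \<Rightarrow> (nat \<Rightarrow> ('n + 'm) rpoly mat) \<Rightarrow>
   (real ^ 'm) set \<Rightarrow> (real ^ 'm) measure \<Rightarrow> 'n rpoly set" where
  "Q1 I J q G Y \<nu> =
     {\<sigma>0 + (\<Sum>j\<in>J. integral_y Y \<nu> (mat_inner (S j) (G j))) | \<sigma>0 S.
        \<sigma>0 \<in> sos_polys I \<and> (\<forall>j\<in>J. S j \<in> sos_mats (vars_xy I) (q j))}"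

end

theory Submission
  imports Defs
begin

text \<open>
  For each \<open>l\<close> let \<open>M l\<close> be the set \<open>Q1\<close> of the \<open>l\<close>-th block of constraints.  It is a quadratic
  module of the ring \<open>\<real>[x(I l)]\<close> (\<open>Q1_quadratic_module\<close>): the square of a polynomial in
  \<open>x\<close> can be moved under the integral and absorbed by the SOS matrices.  The bound on \<open>x(I l)\<close>
  makes this module archimedean.  The theorem then rests on three facts.

  First, a point \<open>x\<close> at which all elements of all \<open>M l\<close> are nonnegative is feasible, so that
  \<open>f\<close> is positive there (\<open>psd_of_nonneg_integrals\<close>).  Indeed the multiplier
  \<open>g(y)\<^sup>2 v v\<^sup>T\<close> shows that \<open>\<integral> g\<^sup>2 (v\<^sup>T G\<^sub>j(x, y) v) d\<nu> \<ge> 0\<close> for every polynomial \<open>g\<close>.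
  Polynomials are dense in the continuous functions on the compact set \<open>Y\<close>, and every
  neighbourhood of a point of \<open>Y\<close> has positive measure, so \<open>v\<^sup>T G\<^sub>j(x, y) v \<ge> 0\<close> on \<open>Y\<close>.

  Secondly, let \<open>K l\<close> be the set on which \<open>M l\<close> is nonnegative.  The running intersection
  property allows writing \<open>f\<close> as a sum of \<open>h l \<in> \<real>[x(I l)]\<close> with \<open>h l\<close> positive on \<open>K l\<close>
  (\<open>sparse_positive_decomposition\<close>).  One splits off the last block; what the other blocks need
  to lend to it is a polynomial in the shared variables that lies between two functions with a
  positive gap, and such a polynomial exists by the Stone-Weierstrass theorem
  (\<open>interpolating_polynomial\<close>).

  Thirdly, for an archimedean quadratic module positivity on its nonnegativity set implies
  membership (\<open>putinar\<close>).  This is proved for arbitrary real algebras, with ring homomorphisms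
  to \<open>\<real>\<close> in the role of points (\<open>positive_on_homs_imp_in_module\<close>): a maximal proper
  quadratic module determines such a homomorphism, so adjoining \<open>- f\<close> must produce \<open>- 1\<close>, and
  from the resulting identity \<open>p f = 1 + m\<close> membership of \<open>f\<close> follows by a descent.
  Applied to each \<open>h l\<close> this gives \<open>h l \<in> M l\<close>, hence the representation of \<open>f\<close>.
\<close>

section \<open>Archimedean quadratic modules in real algebras\<close>

text \<open>
  The real scalars enter through the ring homomorphism \<open>c\<close>, and the algebra is a subset of the
  ambient ring, so that the rings of polynomials in different sets of variables share one type.
\<close>

locale real_subalgebra =
  fixes A :: "'a::comm_ring_1 set" and c :: "real \<Rightarrow> 'a"
  assumes c_one: "c 1 = 1"
    and c_add: "c (r + s) = c r + c s"
    and c_mult: "c (r * s) = c r * c s"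
    and c_in: "c r \<in> A"
    and add_in: "a \<in> A \<Longrightarrow> b \<in> A \<Longrightarrow> a + b \<in> A"
    and mult_in: "a \<in> A \<Longrightarrow> b \<in> A \<Longrightarrow> a * b \<in> A"
begin

lemma c_zero: "c 0 = 0"
  using c_add[of 0 0] by simp

lemma c_uminus: "c (- r) = - c r"
  using c_add[of r "- r"] c_zero by (simp add: eq_neg_iff_add_eq_0 add.commute)

lemma c_diff: "c (r - s) = c r - c s"
  using c_add[of r "- s"] c_uminus by simp

lemma c_inverse: "r \<noteq> 0 \<Longrightarrow> c (1 / r) * c r = 1"
  by (simp add: c_one flip: c_mult)

lemma one_in: "1 \<in> A"
  using c_in[of 1] by (simp add: c_one)

lemma uminus_in: "a \<in> A \<Longrightarrow> - a \<in> A"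
  using mult_in[OF c_in[of "-1"], of a] by (simp add: c_uminus c_one)

lemma diff_in: "a \<in> A \<Longrightarrow> b \<in> A \<Longrightarrow> a - b \<in> A"
  using add_in[of a "- b"] uminus_in by simp

lemma power2_in: "a \<in> A \<Longrightarrow> a\<^sup>2 \<in> A"
  by (simp add: power2_eq_square mult_in)

inductive_set sos :: "'a set" where
  zero: "0 \<in> sos"
| step: "a \<in> A \<Longrightarrow> s \<in> sos \<Longrightarrow> a\<^sup>2 + s \<in> sos"

lemma sos_add: "s \<in> sos \<Longrightarrow> s' \<in> sos \<Longrightarrow> s + s' \<in> sos"
  by (induction rule: sos.induct) (auto simp: add.assoc intro: sos.step)

lemma sos_square: "a \<in> A \<Longrightarrow> a\<^sup>2 \<in> sos"
  using sos.step[OF _ sos.zero] by simp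

lemma sos_square_mult: "s \<in> sos \<Longrightarrow> a \<in> A \<Longrightarrow> a\<^sup>2 * s \<in> sos"
proof (induction rule: sos.induct)
  case (step b s)
  then show ?case
    using sos.step[OF mult_in[of a b]] by (simp add: distrib_left power_mult_distrib)
qed (simp add: sos.zero)

lemma sos_in: "s \<in> sos \<Longrightarrow> s \<in> A"
  by (induction rule: sos.induct) (use c_in[of 0] in \<open>auto simp: c_zero add_in power2_in\<close>)

definition quadratic_module :: "'a set \<Rightarrow> bool" where
  "quadratic_module Q \<longleftrightarrow> 1 \<in> Q \<and> (\<forall>p\<in>Q. \<forall>q\<in>Q. p + q \<in> Q) \<and> (\<forall>a\<in>A. \<forall>q\<in>Q. a\<^sup>2 * q \<in> Q)"

definition archimedean :: "'a set \<Rightarrow> bool" where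
  "archimedean Q \<longleftrightarrow> (\<forall>a\<in>A. \<exists>r. c r - a \<in> Q)"

definition real_hom :: "('a \<Rightarrow> real) \<Rightarrow> bool" where
  "real_hom \<phi> \<longleftrightarrow> (\<forall>r. \<phi> (c r) = r) \<and> (\<forall>a\<in>A. \<forall>b\<in>A. \<phi> (a + b) = \<phi> a + \<phi> b) \<and>
     (\<forall>a\<in>A. \<forall>b\<in>A. \<phi> (a * b) = \<phi> a * \<phi> b)"

context
  fixes Q
  assumes Q: "quadratic_module Q"
begin

lemma qm_add: "p \<in> Q \<Longrightarrow> q \<in> Q \<Longrightarrow> p + q \<in> Q"
  using Q by (auto simp: quadratic_module_def)

lemma qm_square_mult: "a \<in> A \<Longrightarrow> q \<in> Q \<Longrightarrow> a\<^sup>2 * q \<in> Q"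
  using Q by (auto simp: quadratic_module_def)

lemma qm_square: "a \<in> A \<Longrightarrow> a\<^sup>2 \<in> Q"
  using qm_square_mult[of a 1] Q by (auto simp: quadratic_module_def)

lemma qm_nonneg_mult: "q \<in> Q" if "0 \<le> r" "q' \<in> Q" "q = c r * q'" for r q q'
proof -
  have "c r = (c (sqrt r))\<^sup>2"
    using that by (simp add: power2_eq_square flip: c_mult)
  then show ?thesis using qm_square_mult[OF c_in] that by simp
qed

lemma qm_nonneg: "0 \<le> r \<Longrightarrow> c r \<in> Q"
  using qm_nonneg_mult[of r 1] Q by (auto simp: quadratic_module_def)

lemma qm_zero: "0 \<in> Q"
  using qm_nonneg[of 0] by (simp add: c_zero)

lemma qm_sos_mult: "s \<in> sos \<Longrightarrow> q \<in> Q \<Longrightarrow> s * q \<in> Q"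
  by (induction rule: sos.induct) (auto simp: distrib_right qm_add qm_zero qm_square_mult)

lemma qm_sos: "s \<in> sos \<Longrightarrow> s \<in> Q"
  using qm_sos_mult[of s 1] Q by (auto simp: quadratic_module_def)

text \<open>
  Writing \<open>a = ((a + 1) / 2)\<^sup>2 - ((a - 1) / 2)\<^sup>2\<close> shows that the support \<open>Q \<inter> - Q\<close> absorbs
  all elements of \<open>A\<close>, not only squares.
\<close>

lemma qm_support_absorbs:
  assumes "p \<in> Q" "- p \<in> Q" "a \<in> A"
  shows "a * p \<in> Q"
proof -
  have *: "((a + 1) * c (1/2))\<^sup>2 * p \<in> Q" "((a - 1) * c (1/2))\<^sup>2 * (- p) \<in> Q"
    by (rule qm_square_mult; use assms in \<open>auto intro!: mult_in add_in diff_in one_in c_in\<close>)+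
  have "((a + 1) * c (1/2))\<^sup>2 * p + ((a - 1) * c (1/2))\<^sup>2 * (- p)
      = (c (1/2) * c (1/2)) * (4 * (a * p))"
    by (simp add: power2_eq_square algebra_simps)
  also have "\<dots> = (c (1/2) * c (1/2)) * ((c 1 + c 1 + c 1 + c 1) * (a * p))"
    by (simp add: c_one)
  also have "\<dots> = (c (1/2) * c (1/2) * c 4) * (a * p)"
    by (simp add: mult.assoc flip: c_add)
  also have "\<dots> = a * p" by (simp add: c_one flip: c_mult)
  finally show ?thesis using qm_add[OF *] by simp
qed

lemma quadratic_module_adjoin:
  assumes "a \<in> A"
  shows "quadratic_module {q + s * a | q s. q \<in> Q \<and> s \<in> sos}" (is "quadratic_module ?R")
proof -
  have "1 = 1 + 0 * a \<and> 1 \<in> Q \<and> 0 \<in> sos"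
    using qm_nonneg[of 1] sos.zero by (simp add: c_one)
  then have "1 \<in> ?R" by blast
  moreover have "p + q \<in> ?R" if "p \<in> ?R" "q \<in> ?R" for p q
  proof -
    from that obtain q1 s1 q2 s2
      where "p = q1 + s1 * a" "q = q2 + s2 * a" "q1 \<in> Q" "q2 \<in> Q" "s1 \<in> sos" "s2 \<in> sos"
      by blast
    then have "p + q = (q1 + q2) + (s1 + s2) * a" "q1 + q2 \<in> Q" "s1 + s2 \<in> sos"
      by (auto simp: algebra_simps qm_add sos_add)
    then show ?thesis by blast
  qed
  moreover have "b\<^sup>2 * p \<in> ?R" if "b \<in> A" "p \<in> ?R" for b p
  proof -
    from that obtain q s where "p = q + s * a" "q \<in> Q" "s \<in> sos"
      by blast
    then have "b\<^sup>2 * p = b\<^sup>2 * q + (b\<^sup>2 * s) * a" "b\<^sup>2 * q \<in> Q" "b\<^sup>2 * s \<in> sos"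
      using that(1) by (simp add: algebra_simps, simp_all add: qm_square_mult sos_square_mult)
    then show ?thesis by blast
  qed
  ultimately show ?thesis by (auto simp: quadratic_module_def)
qed

text \<open>
  If neither \<open>a\<close> nor \<open>- a\<close> lies in \<open>Q\<close>, then adjoining either of them produces \<open>- 1\<close>, that
  is, \<open>- 1 = q1 + s1 a = q2 - s2 a\<close> with sums of squares \<open>s1\<close> and \<open>s2\<close>.  Eliminating \<open>a\<close> puts
  \<open>s1\<close> into the support, whence \<open>s1 a\<close>, and so \<open>- 1\<close>, lies in \<open>Q\<close>.
\<close>

lemma maximal_quadratic_module_total:
  assumes proper: "- 1 \<notin> Q"
    and maximal: "\<And>R. quadratic_module R \<Longrightarrow> Q \<subseteq> R \<Longrightarrow> - 1 \<notin> R \<Longrightarrow> R = Q"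
    and a: "a \<in> A"
  shows "a \<in> Q \<or> - a \<in> Q"
proof (rule ccontr)
  assume neither: "\<not> (a \<in> Q \<or> - a \<in> Q)"
  have adjoin: "\<exists>q\<in>Q. \<exists>s\<in>sos. - 1 = q + s * b" if b: "b \<in> A" "b \<notin> Q" for b
  proof (rule ccontr)
    let ?R = "{q + s * b | q s. q \<in> Q \<and> s \<in> sos}"
    assume "\<not> ?thesis"
    then have "- 1 \<notin> ?R" by auto
    moreover have "Q \<subseteq> ?R"
    proof
      fix q assume "q \<in> Q"
      then have "q = q + 0 * b \<and> q \<in> Q \<and> 0 \<in> sos" by (simp add: sos.zero)
      then show "q \<in> ?R" by blast
    qed
    ultimately have "?R = Q"
      using maximal quadratic_module_adjoin[OF b(1)] by blast
    moreover have "b \<in> ?R"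
    proof -
      have "b = 0 + 1 * b \<and> 0 \<in> Q \<and> 1 \<in> sos"
        using qm_zero sos_square[OF one_in] by simp
      then show ?thesis by blast
    qed
    ultimately show False using b by blast
  qed
  obtain q1 s1 where 1: "q1 \<in> Q" "s1 \<in> sos" "- 1 = q1 + s1 * a"
    using adjoin[OF a] neither by blast
  obtain q2 s2 where 2: "q2 \<in> Q" "s2 \<in> sos" "- 1 = q2 + s2 * (- a)"
    using adjoin[OF uminus_in[OF a]] neither by blast
  have "s2 * (s1 * a) = s1 * (s2 * a)" by (simp add: algebra_simps)
  moreover have "s1 * a = - 1 - q1" using 1(3) by (simp add: algebra_simps)
  moreover have "s2 * a = 1 + q2" using 2(3) by (simp add: algebra_simps eq_neg_iff_add_eq_0)
  ultimately have "s2 * (- 1 - q1) = s1 * (1 + q2)" by simp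
  then have "- s1 = s2 + s2 * q1 + s1 * q2"
    by (simp add: right_diff_distrib distrib_left) (simp add: eq_diff_eq diff_eq_eq neg_eq_iff_add_eq_0 add_ac)
  moreover have "s2 + s2 * q1 + s1 * q2 \<in> Q"
    using 1 2 by (intro qm_add qm_sos[of s2] qm_sos_mult)
  ultimately have "- s1 \<in> Q" by simp
  then have "a * (- s1) \<in> Q"
    using qm_support_absorbs[of "- s1" a] a qm_sos[OF 1(2)] by simp
  then have "q1 + (s1 * a + a * (- s1)) \<in> Q \<and> q1 + s1 * a \<in> Q"
    using 1 a qm_support_absorbs[of s1 a] \<open>- s1 \<in> Q\<close> qm_sos[OF 1(2)]
    by (auto simp: qm_add mult.commute)
  then show False using proper 1(3) by simp
qed

end

lemma square_bound_identity:
  "(c d - a)\<^sup>2 * (c d + a) + (c d + a)\<^sup>2 * (c d - a) = c (2 * d) * (c (d\<^sup>2) - a\<^sup>2)"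
  using c_add[of d d] c_mult[of d d] by (simp add: power2_eq_square algebra_simps)

text \<open>
  Bounds pass to squares although \<open>Q\<close> need not be closed under products: up to the factor
  \<open>2 d\<close>, the product \<open>(d - a) (d + a)\<close> is a combination of the two factors with squares as
  coefficients.
\<close>

lemma qm_square_bound:
  assumes Q: "quadratic_module Q" and a: "a \<in> A" and d: "0 < d"
    and b: "c d - a \<in> Q" "c d + a \<in> Q"
  shows "c (d\<^sup>2) - a\<^sup>2 \<in> Q"
proof (rule qm_nonneg_mult[OF Q])
  show "(c d - a)\<^sup>2 * (c d + a) + (c d + a)\<^sup>2 * (c d - a) \<in> Q"
    using a b(1)
    by (intro qm_add[OF Q] qm_square_mult[OF Q _ b(2)] qm_square_mult[OF Q _ b(1)] diff_in add_in c_in)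
  show "c (d\<^sup>2) - a\<^sup>2 = c (1 / (2 * d)) *
      ((c d - a)\<^sup>2 * (c d + a) + (c d + a)\<^sup>2 * (c d - a))"
    using c_inverse[of "2 * d"] d by (simp only: square_bound_identity) (simp flip: mult.assoc)
qed (use d in simp)

text \<open>
  In a maximal archimedean module every \<open>a\<close> has exactly one real value, the cut between the
  \<open>r\<close> with \<open>c r - a \<in> Q\<close> and those with \<open>a - c r \<in> Q\<close>.  Stating this as a relation
  avoids computing with infima.
\<close>

definition has_value :: "'a set \<Rightarrow> 'a \<Rightarrow> real \<Rightarrow> bool" where
  "has_value Q a x \<longleftrightarrow> (\<forall>e>0. c (x + e) - a \<in> Q \<and> a - c (x - e) \<in> Q)"

context
  fixes Q
  assumes Q: "quadratic_module Q" and proper: "- 1 \<notin> Q"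
begin

lemma const_in_qm_iff: "c r \<in> Q \<longleftrightarrow> 0 \<le> r"
proof
  show "c r \<in> Q" if "0 \<le> r"
    using that by (rule qm_nonneg[OF Q])
  show "0 \<le> r" if r: "c r \<in> Q"
  proof (rule ccontr)
    assume "\<not> 0 \<le> r"
    then have "- 1 = c (- 1 / r) * c r" "0 \<le> - 1 / r"
      by (auto simp: c_uminus c_one field_simps simp flip: c_mult)
    then show False using qm_nonneg_mult[OF Q _ r] proper by blast
  qed
qed

lemma has_value_unique:
  assumes "has_value Q a x" "has_value Q a y"
  shows "x = y"
proof -
  have "\<not> u < v" if "has_value Q a u" "has_value Q a v" for u v
  proof
    assume "u < v"
    then have "0 < (v - u) / 3" by simp
    then have "(c (u + (v - u) / 3) - a) + (a - c (v - (v - u) / 3)) \<in> Q"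
      using that unfolding has_value_def by (blast intro: qm_add[OF Q])
    then have "c ((u + (v - u) / 3) - (v - (v - u) / 3)) \<in> Q"
      by (simp only: c_diff) (simp add: algebra_simps)
    then show False using \<open>u < v\<close> by (simp add: const_in_qm_iff field_simps)
  qed
  then show ?thesis using assms by (meson linorder_less_linear)
qed

lemma has_value_const: "has_value Q (c r) r"
  by (auto simp: has_value_def const_in_qm_iff simp flip: c_diff)

lemma has_value_add:
  assumes "has_value Q a x" "has_value Q b y"
  shows "has_value Q (a + b) (x + y)"
  unfolding has_value_def
proof (intro allI impI conjI)
  fix e :: real assume "0 < e"
  then have e: "0 < e / 2" by simp
  have "(c (x + e / 2) - a) + (c (y + e / 2) - b) \<in> Q" "(a - c (x - e / 2)) + (b - c (y - e / 2)) \<in> Q"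
    using assms e by (auto simp: has_value_def intro: qm_add[OF Q])
  moreover have "c (x + y + e) = c (x + e / 2) + c (y + e / 2)"
    "c (x + y - e) = c (x - e / 2) + c (y - e / 2)"
    unfolding c_add[symmetric] by (rule arg_cong[of _ _ c], simp)+
  ultimately show "c (x + y + e) - (a + b) \<in> Q" "a + b - c (x + y - e) \<in> Q"
    by (simp_all add: algebra_simps)
qed

lemma has_value_scale:
  assumes "has_value Q a x"
  shows "has_value Q (c r * a) (r * x)"
proof (cases "r = 0")
  case True
  then show ?thesis using has_value_const[of 0] by (simp add: c_zero)
next
  case False
  show ?thesis
    unfolding has_value_def
  proof (intro allI impI conjI)
    fix e :: real assume "0 < e"
    then have e: "0 < e / \<bar>r\<bar>" using False by simp
    have *: "c (x + e / \<bar>r\<bar>) - a \<in> Q" "a - c (x - e / \<bar>r\<bar>) \<in> Q"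
      using assms e by (auto simp: has_value_def)
    note scaled = qm_nonneg_mult[OF Q _ *(1) refl, of "\<bar>r\<bar>"] qm_nonneg_mult[OF Q _ *(2) refl, of "\<bar>r\<bar>"]
    have "\<bar>r\<bar> * (x + e / \<bar>r\<bar>) = \<bar>r\<bar> * x + e" "\<bar>r\<bar> * (x - e / \<bar>r\<bar>) = \<bar>r\<bar> * x - e"
      using False by (auto simp: field_simps)
    then have "c (\<bar>r\<bar> * x + e) - c \<bar>r\<bar> * a \<in> Q" "c \<bar>r\<bar> * a - c (\<bar>r\<bar> * x - e) \<in> Q"
      using scaled by (simp_all add: right_diff_distrib flip: c_mult)
    then show "c (r * x + e) - c r * a \<in> Q" "c r * a - c (r * x - e) \<in> Q"
      by (cases "0 \<le> r"; simp add: c_uminus c_diff c_add algebra_simps)+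
  qed
qed

text \<open>
  Subtracting the value reduces to value \<open>0\<close>; there \<open>\<bar>a\<bar> \<le> sqrt e\<close> yields \<open>a\<^sup>2 \<le> e\<close>.
\<close>

lemma has_value_square:
  assumes v: "has_value Q a x" and a: "a \<in> A"
  shows "has_value Q (a\<^sup>2) (x\<^sup>2)"
proof -
  define b where "b = a - c x"
  have b: "b \<in> A" using a by (auto simp: b_def intro: diff_in c_in)
  have b0: "has_value Q b 0"
    using has_value_add[OF v has_value_const[of "- x"]] by (simp add: b_def c_uminus)
  have "has_value Q (b\<^sup>2) 0"
    unfolding has_value_def
  proof (intro allI impI conjI)
    fix e :: real assume e: "0 < e"
    then have "c (0 + sqrt e) - b \<in> Q" "b - c (0 - sqrt e) \<in> Q"
      using b0 unfolding has_value_def by (metis real_sqrt_gt_zero)+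
    then have "c ((sqrt e)\<^sup>2) - b\<^sup>2 \<in> Q"
      using e b by (intro qm_square_bound[OF Q]) (auto simp: c_uminus add.commute)
    then show "c (0 + e) - b\<^sup>2 \<in> Q" using e by simp
    show "b\<^sup>2 - c (0 - e) \<in> Q"
      using qm_add[OF Q qm_square[OF Q b] qm_nonneg[OF Q, of e]] e by (simp add: c_uminus)
  qed
  then have "has_value Q (b\<^sup>2 + c (2 * x) * b + c (x\<^sup>2)) (0 + (2 * x) * 0 + x\<^sup>2)"
    by (intro has_value_add has_value_scale has_value_const b0)
  moreover have "b\<^sup>2 + c (2 * x) * b + c (x\<^sup>2) = a\<^sup>2"
    using c_add[of x x] c_mult[of x x] by (simp add: b_def power2_eq_square algebra_simps)
  ultimately show ?thesis by simp
qed

text \<open>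
  Polarisation: \<open>4 a b = (a + b)\<^sup>2 - (a - b)\<^sup>2\<close>.
\<close>

lemma has_value_mult:
  assumes v: "has_value Q a x" "has_value Q b y" and a: "a \<in> A" "b \<in> A"
  shows "has_value Q (a * b) (x * y)"
proof -
  have "has_value Q (a + c (- 1) * b) (x + (- 1) * y)"
    by (intro has_value_add has_value_scale v)
  then have minus: "has_value Q (a - b) (x - y)" by (simp add: c_uminus c_one)
  have "has_value Q (c (1/4) * ((a + b)\<^sup>2 + c (- 1) * (a - b)\<^sup>2)) (1/4 * ((x + y)\<^sup>2 + (- 1) * (x - y)\<^sup>2))"
    using a v minus
    by (intro has_value_scale has_value_add has_value_square) (auto intro: add_in diff_in)
  moreover have "1/4 * ((x + y)\<^sup>2 + (- 1) * (x - y)\<^sup>2) = x * y"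
    by (simp add: power2_eq_square algebra_simps)
  moreover have "c (1/4) * ((a + b)\<^sup>2 + c (- 1) * (a - b)\<^sup>2) = a * b"
  proof -
    have "c (1/4) * ((a + b)\<^sup>2 + c (- 1) * (a - b)\<^sup>2) = c (1/4) * (c 1 + c 1 + c 1 + c 1) * (a * b)"
      by (simp add: c_uminus c_one power2_eq_square algebra_simps)
    also have "\<dots> = c (1/4) * c 4 * (a * b)" by (simp flip: c_add)
    also have "\<dots> = a * b" using c_inverse[of 4] by simp
    finally show ?thesis .
  qed
  ultimately show ?thesis by simp
qed

lemma has_value_nonneg:
  assumes "has_value Q q x" "q \<in> Q"
  shows "0 \<le> x"
proof (rule ccontr)
  assume "\<not> 0 \<le> x"
  then have "0 < - x / 2" by simp
  then have "(c (x + (- x / 2)) - q) + q \<in> Q"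
    using assms unfolding has_value_def by (blast intro: qm_add[OF Q])
  then show False using \<open>\<not> 0 \<le> x\<close> by (simp add: const_in_qm_iff)
qed

text \<open>
  The value is the infimum of the upper bounds of \<open>a\<close>: the archimedean property makes it
  finite, and by totality every number that is not an upper bound is a lower bound.
\<close>

lemma has_value_exists:
  assumes arch: "archimedean Q" and total: "\<And>a. a \<in> A \<Longrightarrow> a \<in> Q \<or> - a \<in> Q" and a: "a \<in> A"
  shows "\<exists>x. has_value Q a x"
proof -
  define U where "U = {r. c r - a \<in> Q}"
  obtain R where R: "c R - a \<in> Q" using arch a by (auto simp: archimedean_def)
  obtain N where N: "c N - (- a) \<in> Q"
    using arch uminus_in[OF a] unfolding archimedean_def by blast
  have "U \<noteq> {}" using R by (auto simp: U_def)
  have lower: "- N \<le> r" if "r \<in> U" for r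
  proof -
    have "c (r + N) \<in> Q"
      using qm_add[OF Q _ N, of "c r - a"] that by (simp add: U_def c_add)
    then show ?thesis by (simp add: const_in_qm_iff)
  qed
  then have bdd: "bdd_below U" by (rule bdd_belowI)
  have "has_value Q a (Inf U)"
    unfolding has_value_def
  proof (intro allI impI conjI)
    fix e :: real assume e: "0 < e"
    then obtain r where r: "r \<in> U" "r < Inf U + e"
      using cInf_less_iff[OF \<open>U \<noteq> {}\<close> bdd, of "Inf U + e"] by auto
    then have "(c r - a) + c (Inf U + e - r) \<in> Q"
      by (auto simp: U_def intro!: qm_add[OF Q] qm_nonneg[OF Q])
    then show "c (Inf U + e) - a \<in> Q" by (simp add: c_diff algebra_simps)
    have "Inf U - e \<notin> U" using cInf_lower[OF _ bdd, of "Inf U - e"] e by auto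
    then have "- (c (Inf U - e) - a) \<in> Q"
      using total[OF diff_in[OF c_in a]] by (auto simp: U_def)
    then show "a - c (Inf U - e) \<in> Q" by simp
  qed
  then show ?thesis ..
qed

end

text \<open>
  By Zorn's lemma \<open>M\<close> lies in a maximal proper quadratic module.  That module is total, so
  all elements of \<open>A\<close> have values in it, and taking values respects the ring operations.
\<close>

lemma real_hom_of_proper:
  assumes M: "quadratic_module M" and arch: "archimedean M" and proper: "- 1 \<notin> M"
  shows "\<exists>\<phi>. real_hom \<phi> \<and> (\<forall>m\<in>M \<inter> A. 0 \<le> \<phi> m)"
proof -
  define \<F> where "\<F> = {R. quadratic_module R \<and> M \<subseteq> R \<and> - 1 \<notin> R}"
  have "\<exists>Q\<in>\<F>. \<forall>R\<in>\<F>. Q \<subseteq> R \<longrightarrow> R = Q"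
  proof (rule subset_Zorn_nonempty)
    show "\<F> \<noteq> {}" using M proper by (auto simp: \<F>_def)
    fix \<C> assume ne: "\<C> \<noteq> {}" and chain: "subset.chain \<F> \<C>"
    have sub: "R \<in> \<F>" if "R \<in> \<C>" for R using that chain by (auto simp: subset_chain_def)
    have "p + q \<in> \<Union>\<C>" if "p \<in> \<Union>\<C>" "q \<in> \<Union>\<C>" for p q
    proof -
      from that obtain R S where RS: "R \<in> \<C>" "S \<in> \<C>" "p \<in> R" "q \<in> S" by blast
      then have "R \<subseteq> S \<or> S \<subseteq> R" using chain by (auto simp: subset_chain_def)
      then obtain T where "T \<in> \<C>" "p \<in> T" "q \<in> T" using RS by blast
      then show ?thesis using sub[of T] by (auto simp: \<F>_def quadratic_module_def)
    qed
    moreover have "1 \<in> \<Union>\<C>" using ne sub by (fastforce simp: \<F>_def quadratic_module_def)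
    moreover have "a\<^sup>2 * q \<in> \<Union>\<C>" if "a \<in> A" "q \<in> \<Union>\<C>" for a q
    proof -
      from that obtain R where "R \<in> \<C>" "q \<in> R" by blast
      moreover from this have "a\<^sup>2 * q \<in> R"
        using sub[of R] that(1) by (auto simp: \<F>_def quadratic_module_def)
      ultimately show ?thesis by blast
    qed
    ultimately have "quadratic_module (\<Union>\<C>)" by (auto simp: quadratic_module_def)
    moreover have "M \<subseteq> \<Union>\<C>" "- 1 \<notin> \<Union>\<C>" using ne sub by (auto simp: \<F>_def)
    ultimately show "\<Union>\<C> \<in> \<F>" by (simp add: \<F>_def)
  qed
  then obtain Q where "Q \<in> \<F>" and max: "\<And>R. R \<in> \<F> \<Longrightarrow> Q \<subseteq> R \<Longrightarrow> R = Q" by blast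
  then have Q: "quadratic_module Q" and MQ: "M \<subseteq> Q" and proper': "- 1 \<notin> Q"
    by (auto simp: \<F>_def)
  have arch': "archimedean Q" using arch MQ unfolding archimedean_def by blast
  have total: "a \<in> Q \<or> - a \<in> Q" if "a \<in> A" for a
  proof (rule maximal_quadratic_module_total[OF Q proper' _ that])
    fix R assume "quadratic_module R" "Q \<subseteq> R" "- 1 \<notin> R"
    then show "R = Q" using max MQ by (auto simp: \<F>_def)
  qed
  define \<phi> where "\<phi> a = (THE x. has_value Q a x)" for a
  have \<phi>_eq: "\<phi> a = x" if "has_value Q a x" for a x
    unfolding \<phi>_def using that has_value_unique[OF Q proper'] by blast
  have \<phi>: "has_value Q a (\<phi> a)" if "a \<in> A" for a
    using has_value_exists[OF Q proper' arch' total that] \<phi>_eq by auto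
  have "real_hom \<phi>"
    unfolding real_hom_def using \<phi>
    by (auto intro!: \<phi>_eq has_value_add[OF Q proper'] has_value_mult[OF Q proper']
        has_value_const[OF Q proper'])
  moreover have "\<forall>m\<in>M \<inter> A. 0 \<le> \<phi> m"
    using \<phi> MQ has_value_nonneg[OF Q proper'] by blast
  ultimately show ?thesis by blast
qed

text \<open>
  Jacobi's representation theorem.  There is no homomorphism that is nonnegative on the module
  generated by \<open>M\<close> and \<open>- f\<close>, so this module contains \<open>- 1\<close>, which means
  \<open>p f - 1 \<in> M\<close> for a sum of squares \<open>p\<close>.  Choose \<open>k\<close> with \<open>2 k - p\<close> and \<open>k - p\<^sup>2 f\<close> in \<open>M\<close>.  Then
  \<open>k\<^sup>2 (f + r) - k = (k - p)\<^sup>2 (f + r) + 2 k (p f - 1) + (k - p\<^sup>2 f) + r p (2 k - p)\<close>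
  shows that \<open>f + r \<in> M\<close> with \<open>r \<ge> 0\<close> implies \<open>f + r - 1 / k \<in> M\<close>.  The step \<open>1 / k\<close> does not
  depend on \<open>r\<close>, so finitely many steps lead from some \<open>f + N \<in> M\<close> to \<open>f \<in> M\<close>.
\<close>

lemma positive_on_homs_imp_in_module:
  assumes M: "quadratic_module M" and arch: "archimedean M" and f: "f \<in> A"
    and pos: "\<And>\<phi>. real_hom \<phi> \<Longrightarrow> \<forall>m\<in>M \<inter> A. 0 \<le> \<phi> m \<Longrightarrow> 0 < \<phi> f"
  shows "f \<in> M"
proof -
  let ?R = "{q + s * (- f) | q s. q \<in> M \<and> s \<in> sos}"
  have R: "quadratic_module ?R"
    by (rule quadratic_module_adjoin[OF M uminus_in[OF f]])
  have MR: "M \<subseteq> ?R"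
  proof
    fix q assume "q \<in> M"
    then have "q = q + 0 * (- f) \<and> q \<in> M \<and> 0 \<in> sos" by (simp add: sos.zero)
    then show "q \<in> ?R" by blast
  qed
  have fR: "- f \<in> ?R"
  proof -
    have "- f = 0 + 1 * (- f) \<and> 0 \<in> M \<and> 1 \<in> sos"
      using qm_zero[OF M] sos_square[OF one_in] by simp
    then show ?thesis by blast
  qed
  have "- 1 \<in> ?R"
  proof (rule ccontr)
    assume "- 1 \<notin> ?R"
    moreover have "archimedean ?R" using arch MR unfolding archimedean_def by blast
    ultimately obtain \<phi> where hom: "real_hom \<phi>" and nonneg: "\<forall>m\<in>?R \<inter> A. 0 \<le> \<phi> m"
      using real_hom_of_proper[OF R] by blast
    have f_pos: "0 < \<phi> f" using pos[OF hom] nonneg MR by blast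
    have minus_f: "0 \<le> \<phi> (- f)" using nonneg fR uminus_in[OF f] by blast
    have "\<phi> (c (- 1) * f) = \<phi> (c (- 1)) * \<phi> f"
      using hom f c_in unfolding real_hom_def by blast
    moreover have "\<phi> (c (- 1)) = - 1" using hom unfolding real_hom_def by blast
    ultimately have "\<phi> (- f) = - \<phi> f" by (simp add: c_uminus c_one)
    then show False using f_pos minus_f by simp
  qed
  then obtain m p where m: "m \<in> M" and p: "p \<in> sos" and eq: "- 1 = m + p * (- f)"
    by blast
  have pf: "p * f - 1 \<in> M" using m eq by (simp add: eq_neg_iff_add_eq_0 algebra_simps)
  have pA: "p \<in> A" using p by (rule sos_in)
  obtain k1 where k1: "c k1 - p \<in> M" using arch pA by (auto simp: archimedean_def)
  obtain k2 where k2: "c k2 - p\<^sup>2 * f \<in> M"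
    using arch mult_in[OF power2_in[OF pA] f] unfolding archimedean_def by blast
  define k where "k = max 1 (max k1 k2)"
  have k: "1 \<le> k" "k1 \<le> k" "k2 \<le> k" by (auto simp: k_def)
  have "c (2 * k - k1) + (c k1 - p) \<in> M" "c (k - k2) + (c k2 - p\<^sup>2 * f) \<in> M"
    using k by (auto intro!: qm_add[OF M] k1 k2 qm_nonneg[OF M])
  then have b1: "c (2 * k) - p \<in> M" and b2: "c k - p\<^sup>2 * f \<in> M"
    by (simp_all add: c_diff)
  have upward: "f + c r' \<in> M" if "f + c r \<in> M" "r \<le> r'" for r r'
    using qm_add[OF M that(1) qm_nonneg[OF M, of "r' - r"]] that(2) by (simp add: c_diff)
  have lower: "f + c (r - 1 / k) \<in> M" if r: "f + c r \<in> M" "0 \<le> r" for r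
  proof (rule qm_nonneg_mult[OF M])
    (* s equals k^2 (f + r) - k; the coefficients of f + r and of r (2 k - p) are sums of squares,
       and all the other terms are in M already *)
    define s where "s = (c k - p)\<^sup>2 * (f + c r) + c (2 * k) * (p * f - 1) + (c k - p\<^sup>2 * f)
        + c r * (p * (c (2 * k) - p))"
    show "s \<in> M"
      unfolding s_def using r k b2 pf pA
      by (auto intro!: qm_add[OF M] qm_square_mult[OF M] diff_in c_in qm_nonneg_mult[OF M _ _ refl]
          qm_sos_mult[OF M p b1])
    have s_eq: "s = c k * c k * (f + c r) - c k"
      unfolding s_def using c_add[of k k] by (simp add: power2_eq_square algebra_simps)
    have "c (1 / k\<^sup>2) * (c k * c k) = 1" "c (1 / k\<^sup>2) * c k = c (1 / k)"
      using k by (auto simp: c_one power2_eq_square simp flip: c_mult)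
    then show "f + c (r - 1 / k) = c (1 / k\<^sup>2) * s"
      by (simp add: s_eq right_diff_distrib c_diff flip: mult.assoc)
  qed (use k in simp)
  have descend: "f \<in> M" if "f + c r \<in> M" "r \<le> real n / k" for r n
    using that
  proof (induction n arbitrary: r)
    case 0
    then show ?case using upward[of r 0] by (simp add: c_zero)
  next
    case (Suc n)
    show ?case
    proof (cases "r \<le> 0")
      case True
      then show ?thesis using upward[of r 0] Suc.prems by (simp add: c_zero)
    next
      case False
      then show ?thesis
        using lower[of r] Suc.prems by (intro Suc.IH[of "r - 1 / k"]) (auto simp: add_divide_distrib)
    qed
  qed
  obtain N where "c N - (- f) \<in> M"
    using arch uminus_in[OF f] unfolding archimedean_def by blast
  then have "f + c N \<in> M" by (simp add: add.commute)
  moreover obtain n :: nat where "N * k \<le> real n" using real_arch_simple by blast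
  then have "N \<le> real n / k" using k by (simp add: field_simps)
  ultimately show ?thesis by (rule descend)
qed


text \<open>
  The elements of \<open>A\<close> that are bounded with respect to \<open>Q\<close> form a subring; this is why the archimedean property
  only has to be verified on generators.
\<close>

definition bounded_in :: "'a set \<Rightarrow> 'a \<Rightarrow> bool" where
  "bounded_in Q a \<longleftrightarrow> (\<exists>r>0. c r - a \<in> Q \<and> c r + a \<in> Q)"

context
  fixes Q
  assumes Q: "quadratic_module Q"
begin

lemma bounded_in_const: "bounded_in Q (c r)"
  unfolding bounded_in_def
proof (intro exI conjI)
  show "c (\<bar>r\<bar> + 1) - c r \<in> Q" "c (\<bar>r\<bar> + 1) + c r \<in> Q"
    by (auto simp flip: c_diff c_add intro: qm_nonneg[OF Q])
qed simp

lemma bounded_in_add: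
  assumes "bounded_in Q a" "bounded_in Q b"
  shows "bounded_in Q (a + b)"
proof -
  obtain r s where "0 < r" "0 < s" "c r - a \<in> Q" "c r + a \<in> Q" "c s - b \<in> Q" "c s + b \<in> Q"
    using assms by (auto simp: bounded_in_def)
  moreover from this have "(c r - a) + (c s - b) \<in> Q" "(c r + a) + (c s + b) \<in> Q"
    by (auto intro!: qm_add[OF Q])
  moreover have "(c r - a) + (c s - b) = c (r + s) - (a + b)"
    "(c r + a) + (c s + b) = c (r + s) + (a + b)"
    by (simp_all add: c_add algebra_simps)
  ultimately show ?thesis unfolding bounded_in_def by (metis add_pos_pos)
qed

lemma bounded_in_uminus: "bounded_in Q a \<Longrightarrow> bounded_in Q (- a)"
  by (auto simp: bounded_in_def)

text \<open>
  Polarisation reduces products to squares, which are bounded by \<open>qm_square_bound\<close>.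
\<close>

lemma bounded_in_mult:
  assumes ab: "bounded_in Q a" "bounded_in Q b" and A: "a \<in> A" "b \<in> A"
  shows "bounded_in Q (a * b)"
proof -
  have square: "\<exists>r>0. \<forall>s\<ge>r. c s - d\<^sup>2 \<in> Q" if d: "bounded_in Q d" "d \<in> A" for d
  proof -
    obtain r where r: "0 < r" "c r - d \<in> Q" "c r + d \<in> Q"
      using d by (auto simp: bounded_in_def)
    have "c s - d\<^sup>2 \<in> Q" if "r\<^sup>2 \<le> s" for s
      using qm_add[OF Q qm_square_bound[OF Q d(2) r] qm_nonneg[OF Q, of "s - r\<^sup>2"]] that
      by (simp add: c_diff)
    then show ?thesis using r(1) by (intro exI[of _ "r\<^sup>2"]) auto
  qed
  have minus: "bounded_in Q (a - b)"
    using bounded_in_add[OF ab(1) bounded_in_uminus[OF ab(2)]] by simp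
  obtain r s where rs: "0 < r" "\<forall>u\<ge>r. c u - (a + b)\<^sup>2 \<in> Q" "0 < s" "\<forall>u\<ge>s. c u - (a - b)\<^sup>2 \<in> Q"
    using square[OF bounded_in_add[OF ab] add_in[OF A]] square[OF minus diff_in[OF A]] by blast
  define u where "u = max r s"
  have "(c u - (a + b)\<^sup>2) + (a - b)\<^sup>2 \<in> Q" "(c u - (a - b)\<^sup>2) + (a + b)\<^sup>2 \<in> Q"
    using rs A by (auto simp: u_def intro!: qm_add[OF Q] qm_square[OF Q] add_in diff_in)
  moreover have "c (u / 4) - a * b = c (1/4) * ((c u - (a + b)\<^sup>2) + (a - b)\<^sup>2)"
    "c (u / 4) + a * b = c (1/4) * ((c u - (a - b)\<^sup>2) + (a + b)\<^sup>2)"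
  proof -
    have four: "c (1/4) * (4 * (a * b)) = a * b"
      using c_inverse[of 4] c_add[of 1 1] c_add[of 2 2] by (simp add: c_one flip: mult.assoc)
    have "(c u - (a + b)\<^sup>2) + (a - b)\<^sup>2 = c u - 4 * (a * b)"
      "(c u - (a - b)\<^sup>2) + (a + b)\<^sup>2 = c u + 4 * (a * b)"
      by (simp_all add: power2_eq_square algebra_simps)
    moreover have "c (u / 4) = c (1/4) * c u" by (simp flip: c_mult)
    ultimately show "c (u / 4) - a * b = c (1/4) * ((c u - (a + b)\<^sup>2) + (a - b)\<^sup>2)"
      "c (u / 4) + a * b = c (1/4) * ((c u - (a - b)\<^sup>2) + (a + b)\<^sup>2)"
      by (simp_all only: right_diff_distrib distrib_left four)
  qed
  ultimately have "c (u / 4) - a * b \<in> Q" "c (u / 4) + a * b \<in> Q"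
    using qm_nonneg_mult[OF Q, of "1/4"] by auto
  moreover have "0 < u / 4" using rs by (simp add: u_def)
  ultimately show ?thesis unfolding bounded_in_def by blast
qed

text \<open>
  For a suitable constant \<open>s\<close> one has
  \<open>2 (\<bar>r\<bar> + 1 - a) = (r - a\<^sup>2) + (a - 1)\<^sup>2 + s\<close> with \<open>s \<ge> 0\<close>, and likewise for \<open>- a\<close>.
\<close>

lemma bounded_in_of_square:
  assumes a: "a \<in> A" and r: "c r - a\<^sup>2 \<in> Q"
  shows "bounded_in Q a"
proof -
  have "c (\<bar>r\<bar> + 1) - a = c (1/2) * ((c r - a\<^sup>2) + (a - 1)\<^sup>2 + c (2 * \<bar>r\<bar> + 1 - r))"
    "c (\<bar>r\<bar> + 1) + a = c (1/2) * ((c r - a\<^sup>2) + (a + 1)\<^sup>2 + c (2 * \<bar>r\<bar> + 1 - r))"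
  proof -
    have two: "c (1/2) * (2 * b) = b" for b
      using c_inverse[of 2] c_add[of 1 1] by (simp add: c_one flip: mult.assoc)
    have "(c r - a\<^sup>2) + (a - 1)\<^sup>2 + c (2 * \<bar>r\<bar> + 1 - r) = 2 * (c (\<bar>r\<bar> + 1) - a)"
      "(c r - a\<^sup>2) + (a + 1)\<^sup>2 + c (2 * \<bar>r\<bar> + 1 - r) = 2 * (c (\<bar>r\<bar> + 1) + a)"
      using c_add[of "\<bar>r\<bar>" "\<bar>r\<bar>"]
      by (simp_all add: power2_eq_square algebra_simps c_diff c_add c_one)
    then show "c (\<bar>r\<bar> + 1) - a = c (1/2) * ((c r - a\<^sup>2) + (a - 1)\<^sup>2 + c (2 * \<bar>r\<bar> + 1 - r))"
      "c (\<bar>r\<bar> + 1) + a = c (1/2) * ((c r - a\<^sup>2) + (a + 1)\<^sup>2 + c (2 * \<bar>r\<bar> + 1 - r))"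
      by (simp_all only: two)
  qed
  moreover have "(c r - a\<^sup>2) + (a - 1)\<^sup>2 + c (2 * \<bar>r\<bar> + 1 - r) \<in> Q"
    "(c r - a\<^sup>2) + (a + 1)\<^sup>2 + c (2 * \<bar>r\<bar> + 1 - r) \<in> Q"
    using a r by (auto intro!: qm_add[OF Q] qm_square[OF Q] qm_nonneg[OF Q] add_in diff_in one_in)
  ultimately have "c (\<bar>r\<bar> + 1) - a \<in> Q" "c (\<bar>r\<bar> + 1) + a \<in> Q"
    using qm_nonneg_mult[OF Q, of "1/2"] by auto
  then show ?thesis unfolding bounded_in_def by (intro exI[of _ "\<bar>r\<bar> + 1"]) auto
qed

end

end

section \<open>Polynomials and their evaluation\<close>

lemma poly_mapping_sum_singles:
  "p = (\<Sum>\<mu>\<in>Poly_Mapping.keys p. Poly_Mapping.single \<mu> (Poly_Mapping.lookup p \<mu>))"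
proof (rule poly_mapping_eqI)
  fix \<nu>
  show "Poly_Mapping.lookup p \<nu> =
      Poly_Mapping.lookup (\<Sum>\<mu>\<in>Poly_Mapping.keys p. Poly_Mapping.single \<mu> (Poly_Mapping.lookup p \<mu>)) \<nu>"
    by (cases "\<nu> \<in> Poly_Mapping.keys p")
      (auto simp: lookup_sum lookup_single when_def in_keys_iff)
qed

lemma polys_in_single: "Poly_Mapping.keys \<mu> \<subseteq> V \<Longrightarrow> Poly_Mapping.single \<mu> r \<in> polys_in V"
  by (auto simp: polys_in_def split: if_splits)

lemma polys_in_add: "p \<in> polys_in V \<Longrightarrow> q \<in> polys_in V \<Longrightarrow> p + q \<in> polys_in V"
  using keys_add[of p q] by (auto simp: polys_in_def)

lemma polys_in_mult:
  fixes p q :: "'v rpoly"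
  assumes "p \<in> polys_in V" "q \<in> polys_in V"
  shows "p * q \<in> polys_in V"
  unfolding polys_in_def
proof (intro CollectI ballI)
  fix \<mu> assume "\<mu> \<in> Poly_Mapping.keys (p * q)"
  then obtain a b where "\<mu> = a + b" "a \<in> Poly_Mapping.keys p" "b \<in> Poly_Mapping.keys q"
    using keys_mult[of p q] by blast
  moreover from this have "Poly_Mapping.keys a \<subseteq> V" "Poly_Mapping.keys b \<subseteq> V"
    using assms by (auto simp: polys_in_def)
  ultimately show "Poly_Mapping.keys \<mu> \<subseteq> V"
    using keys_add[of a b] by blast
qed

lemma polys_in_Const: "Const r \<in> polys_in V"
  by (simp add: Const_def polys_in_single)

lemma polys_in_Var: "v \<in> V \<Longrightarrow> Var v \<in> polys_in V"
  by (simp add: Var_def polys_in_single)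

lemma polys_in_zero: "0 \<in> polys_in V"
  by (simp add: polys_in_def)

lemma polys_in_sum: "(\<And>i. i \<in> K \<Longrightarrow> p i \<in> polys_in V) \<Longrightarrow> (\<Sum>i\<in>K. p i) \<in> polys_in V"
  by (induction K rule: infinite_finite_induct) (auto simp: polys_in_add polys_in_zero)

lemma polys_in_mono: "p \<in> polys_in V \<Longrightarrow> V \<subseteq> W \<Longrightarrow> p \<in> polys_in W"
  by (auto simp: polys_in_def)

interpretation poly: real_subalgebra "polys_in V" Const for V :: "'v set"
  by unfold_locales
    (auto simp: Const_def single_add mult_single polys_in_add polys_in_mult polys_in_single)

text \<open>
  For properties of additive maps.
\<close>

lemma polys_in_single_induct [consumes 1, case_names single add]:
  assumes p: "p \<in> polys_in V"
    and single: "\<And>\<mu> r. Poly_Mapping.keys \<mu> \<subseteq> V \<Longrightarrow> P (Poly_Mapping.single \<mu> r)"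
    and add: "\<And>p q. P p \<Longrightarrow> P q \<Longrightarrow> P (p + q)"
  shows "P p"
proof -
  have "P (\<Sum>\<mu>\<in>K. Poly_Mapping.single \<mu> (Poly_Mapping.lookup p \<mu>))"
    if "finite K" "\<forall>\<mu>\<in>K. Poly_Mapping.keys \<mu> \<subseteq> V" for K
    using that
  proof (induction K rule: finite_induct)
    case empty
    then show ?case using single[of 0 0] by simp
  qed (auto simp: single add)
  then show ?thesis
    using p by (subst poly_mapping_sum_singles) (simp add: polys_in_def)
qed

lemma Var_power: "Var v ^ k = Poly_Mapping.single (Poly_Mapping.single v k) 1"
  by (induction k) (auto simp: Var_def mult_single simp flip: single_add)

lemma single_eq_prod_Var:
  "Poly_Mapping.single \<mu> r = Const r * (\<Prod>v\<in>Poly_Mapping.keys \<mu>. Var v ^ Poly_Mapping.lookup \<mu> v)"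
proof -
  have "(\<Prod>v\<in>K. Var v ^ k v) = Poly_Mapping.single (\<Sum>v\<in>K. Poly_Mapping.single v (k v)) 1"
    if "finite K" for K :: "'a set" and k
    using that by (induction K rule: finite_induct) (auto simp: Var_power mult_single)
  then show ?thesis
    by (simp add: Const_def mult_single flip: poly_mapping_sum_singles)
qed

text \<open>
  For properties of ring homomorphisms; the variables in \<open>V\<close> and the constants generate the ring.
\<close>

lemma polys_in_induct [consumes 1, case_names Const Var add mult]:
  assumes p: "p \<in> polys_in V"
    and Const: "\<And>r. P (Const r)"
    and Var: "\<And>v. v \<in> V \<Longrightarrow> P (Var v)"
    and add: "\<And>p q. p \<in> polys_in V \<Longrightarrow> q \<in> polys_in V \<Longrightarrow> P p \<Longrightarrow> P q \<Longrightarrow> P (p + q)"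
    and mult: "\<And>p q. p \<in> polys_in V \<Longrightarrow> q \<in> polys_in V \<Longrightarrow> P p \<Longrightarrow> P q \<Longrightarrow> P (p * q)"
  shows "P p"
proof -
  let ?P = "\<lambda>p. p \<in> polys_in V \<and> P p"
  have power: "?P (Var v ^ k)" if "v \<in> V" for v and k :: nat
    using that Const[of 1] poly.one_in
    by (induction k) (auto simp: Var mult polys_in_mult polys_in_Var poly.c_one)
  have prod: "?P (\<Prod>v\<in>K. Var v ^ k v)" if "finite K" "K \<subseteq> V" for K :: "'a set" and k :: "'a \<Rightarrow> nat"
    using that
  proof (induction K rule: finite_induct)
    case empty
    then show ?case using Const[of 1] poly.one_in by (simp add: poly.c_one)
  qed (use power in \<open>auto intro!: mult polys_in_mult\<close>)
  have "?P p" using p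
  proof (induction rule: polys_in_single_induct)
    case (single \<mu> r)
    then show ?case
      using prod[of "Poly_Mapping.keys \<mu>"] Const
      by (subst (1 2) single_eq_prod_Var) (auto intro!: mult polys_in_mult polys_in_Const)
  qed (auto intro: add polys_in_add)
  then show ?thesis ..
qed

lemma eval_monom_superset:
  assumes "finite S" "Poly_Mapping.keys \<mu> \<subseteq> S"
  shows "eval_monom x \<mu> = (\<Prod>v\<in>S. x v ^ Poly_Mapping.lookup \<mu> v)"
  unfolding eval_monom_def using assms
  by (intro prod.mono_neutral_left) (auto simp: in_keys_iff)

lemma eval_monom_add: "eval_monom x (\<mu> + \<nu>) = eval_monom x \<mu> * eval_monom x \<nu>"
proof -
  let ?S = "Poly_Mapping.keys \<mu> \<union> Poly_Mapping.keys \<nu>"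
  have "finite ?S" "Poly_Mapping.keys (\<mu> + \<nu>) \<subseteq> ?S" using keys_add[of \<mu> \<nu>] by auto
  then show ?thesis
    by (simp add: eval_monom_superset[of ?S] lookup_add power_add prod.distrib)
qed

lemma eval_superset:
  assumes "finite S" "Poly_Mapping.keys p \<subseteq> S"
  shows "eval x p = (\<Sum>\<mu>\<in>S. Poly_Mapping.lookup p \<mu> * eval_monom x \<mu>)"
  unfolding eval_def using assms
  by (intro sum.mono_neutral_left) (auto simp: in_keys_iff)

lemma eval_add: "eval x (p + q) = eval x p + eval x q"
proof -
  let ?S = "Poly_Mapping.keys p \<union> Poly_Mapping.keys q"
  have "finite ?S" "Poly_Mapping.keys (p + q) \<subseteq> ?S" using keys_add[of p q] by auto
  then show ?thesis
    by (simp add: eval_superset[of ?S] lookup_add distrib_right sum.distrib)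
qed

lemma eval_single: "eval x (Poly_Mapping.single \<mu> r) = r * eval_monom x \<mu>"
  by (simp add: eval_def)

lemma in_polys_in_UNIV: "p \<in> polys_in UNIV"
  by (simp add: polys_in_def)

lemma eval_mult: "eval x (p * q) = eval x p * eval x q"
  using in_polys_in_UNIV[of p]
proof (induction rule: polys_in_single_induct)
  case (single \<mu> r)
  show ?case
    using in_polys_in_UNIV[of q]
    by (induction rule: polys_in_single_induct)
      (auto simp: distrib_left eval_add mult_single eval_single eval_monom_add)
qed (auto simp: distrib_right eval_add)

lemma eval_Const [simp]: "eval x (Const r) = r"
  by (simp add: Const_def eval_single eval_monom_def)

lemma eval_Var [simp]: "eval x (Var v) = x v"
  by (simp add: Var_def eval_single eval_monom_def)

lemma eval_zero [simp]: "eval x 0 = 0"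
  by (simp add: eval_def)

lemma eval_one [simp]: "eval x 1 = 1"
  using eval_Const[of x 1] by (simp add: poly.c_one)

lemma eval_uminus: "eval x (- p) = - eval x p"
  using eval_add[of x p "- p"] by simp

lemma eval_diff: "eval x (p - q) = eval x p - eval x q"
  using eval_add[of x p "- q"] by (simp add: eval_uminus)

lemma eval_power: "eval x (p ^ k) = eval x p ^ k"
  by (induction k) (auto simp: eval_mult)

lemma eval_sum: "eval x (\<Sum>i\<in>K. p i) = (\<Sum>i\<in>K. eval x (p i))"
  by (induction K rule: infinite_finite_induct) (auto simp: eval_add)

lemmas eval_simps = eval_add eval_mult eval_uminus eval_diff eval_power eval_sum

lemma eval_cong:
  assumes "p \<in> polys_in V" "\<And>v. v \<in> V \<Longrightarrow> x v = y v"
  shows "eval x p = eval y p"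
  using assms(1) by (induction rule: polys_in_induct) (auto simp: eval_simps assms(2))

lemma continuous_on_eval [continuous_intros]:
  assumes "\<And>v. continuous_on S (\<lambda>y. z y v)"
  shows "continuous_on S (\<lambda>y. eval (z y) p)"
  using in_polys_in_UNIV[of p]
  by (induction rule: polys_in_induct) (auto simp: eval_simps intro!: continuous_intros assms)

text \<open>
  Every homomorphism to \<open>\<real>\<close> is the evaluation at a point, which turns the abstract
  representation theorem into one about nonnegativity sets.
\<close>

lemma real_hom_eq_eval:
  assumes \<phi>: "poly.real_hom V \<phi>" and p: "p \<in> polys_in V"
  shows "\<phi> p = eval (\<lambda>v. \<phi> (Var v)) p"
  using p by (induction rule: polys_in_induct) (use \<phi> in \<open>auto simp: poly.real_hom_def eval_simps\<close>)

text \<open>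
  The squares of the other variables belong to \<open>M\<close>, so the bound on the sum of all squares
  bounds each single variable, and therefore every polynomial.
\<close>

theorem putinar:
  fixes V :: "'v::finite set"
  assumes M: "poly.quadratic_module V M" and C: "Const C - (\<Sum>v\<in>V. Var v ^ 2) \<in> M"
    and MV: "M \<subseteq> polys_in V"
    and f: "f \<in> polys_in V"
    and pos: "\<And>x. (\<And>m. m \<in> M \<Longrightarrow> 0 \<le> eval x m) \<Longrightarrow> 0 < eval x f"
  shows "f \<in> M"
proof (rule poly.positive_on_homs_imp_in_module[OF M _ f])
  have Var: "poly.bounded_in M (Var v)" if v: "v \<in> V" for v
  proof (rule poly.bounded_in_of_square[OF M polys_in_Var[OF v]])
    have "(\<Sum>w\<in>W. Var w ^ 2) \<in> M" if "W \<subseteq> V" for W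
      using finite[of W] that
      by (induction W rule: finite_induct)
        (auto intro!: poly.qm_zero[OF M] poly.qm_add[OF M] poly.qm_square[OF M] polys_in_Var)
    then have "(Const C - (\<Sum>w\<in>V. Var w ^ 2)) + (\<Sum>w\<in>V - {v}. Var w ^ 2) \<in> M"
      by (intro poly.qm_add[OF M C]) auto
    also have "(Const C - (\<Sum>w\<in>V. Var w ^ 2)) + (\<Sum>w\<in>V - {v}. Var w ^ 2) = Const C - Var v ^ 2"
      using v by (simp add: sum.remove[of V v])
    finally show "Const C - (Var v)\<^sup>2 \<in> M" .
  qed
  have "poly.bounded_in M p" if "p \<in> polys_in V" for p
    using that
    by (induction rule: polys_in_induct)
      (auto intro: Var poly.bounded_in_const[OF M] poly.bounded_in_add[OF M] poly.bounded_in_mult[OF M])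
  then show "poly.archimedean V M"
    unfolding poly.archimedean_def poly.bounded_in_def by blast
next
  fix \<phi> assume \<phi>: "poly.real_hom V \<phi>" "\<forall>m\<in>M \<inter> polys_in V. 0 \<le> \<phi> m"
  then have "0 < eval (\<lambda>v. \<phi> (Var v)) f"
    using MV by (intro pos) (auto simp flip: real_hom_eq_eval[OF \<phi>(1)])
  then show "0 < \<phi> f" by (simp add: real_hom_eq_eval[OF \<phi>(1) f])
qed

section \<open>Positive decompositions under the running intersection property\<close>

text \<open>
  Points of \<open>\<real>\<^sup>V\<close> are represented by the points of \<open>\<real>\<^sup>n\<close> that vanish outside \<open>V\<close>.
\<close>

definition restr :: "'n set \<Rightarrow> real ^ 'n \<Rightarrow> real ^ 'n" where
  "restr V x = (\<chi> i. if i \<in> V then vec_nth x i else 0)"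

lemma restr_nth [simp]: "vec_nth (restr V x) i = (if i \<in> V then vec_nth x i else 0)"
  by (simp add: restr_def)

lemma restr_eq_iff: "restr V x = restr V y \<longleftrightarrow> (\<forall>i\<in>V. vec_nth x i = vec_nth y i)"
  by (auto simp: Finite_Cartesian_Product.vec_eq_iff)

lemma restr_idem: "restr V (restr V x) = restr V x"
  by (simp add: Finite_Cartesian_Product.vec_eq_iff)

lemma eval_restr: "p \<in> polys_in V \<Longrightarrow> eval (vec_nth (restr V x)) p = eval (vec_nth x) p"
  by (rule eval_cong) auto

lemma continuous_on_restr: "continuous_on S (restr V)"
proof -
  have "continuous_on S (\<lambda>x. \<chi> i. if i \<in> V then vec_nth x i else 0)"
  proof (rule continuous_on_vec_lambda)
    fix i show "continuous_on S (\<lambda>x. if i \<in> V then vec_nth x i else 0)"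
      by (cases "i \<in> V") (auto intro!: continuous_intros)
  qed
  then show ?thesis by (simp add: restr_def[abs_def])
qed

text \<open>
  Polynomials in the variables \<open>V\<close> separate two points exactly if these differ in a coordinate
  of \<open>V\<close>; hence the restriction to points that vanish outside \<open>V\<close>.
\<close>

lemma polys_in_dense:
  fixes S :: "(real ^ 'n::finite) set" and w :: "real ^ 'n \<Rightarrow> real"
  assumes S: "compact S" "\<And>z. z \<in> S \<Longrightarrow> restr V z = z"
    and w: "continuous_on S w" and e: "0 < e"
  shows "\<exists>p\<in>polys_in V. \<forall>z\<in>S. \<bar>w z - eval (vec_nth z) p\<bar> < e"
proof -
  let ?P = "\<lambda>g. \<exists>p\<in>polys_in V. g = (\<lambda>z. eval (vec_nth z) p)"
  have "\<exists>g. ?P g \<and> (\<forall>z\<in>S. \<bar>w z - g z\<bar> < e)"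
  proof (rule Stone_Weierstrass_HOL[OF S(1) _ _ _ _ _ w e])
    show "?P (\<lambda>x. r)" for r
      by (rule bexI[of _ "Const r"]) (auto simp: polys_in_Const)
    show "continuous_on S g" if "?P g" for g
      using that by (auto intro!: continuous_intros)
    show "?P (\<lambda>x. g x + h x)" if "?P g \<and> ?P h" for g h
    proof -
      from that obtain p q where "p \<in> polys_in V" "q \<in> polys_in V"
        "g = (\<lambda>z. eval (vec_nth z) p)" "h = (\<lambda>z. eval (vec_nth z) q)" by blast
      then show ?thesis by (intro bexI[of _ "p + q"]) (auto simp: eval_simps polys_in_add)
    qed
    show "?P (\<lambda>x. g x * h x)" if "?P g \<and> ?P h" for g h
    proof -
      from that obtain p q where "p \<in> polys_in V" "q \<in> polys_in V"
        "g = (\<lambda>z. eval (vec_nth z) p)" "h = (\<lambda>z. eval (vec_nth z) q)" by blast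
      then show ?thesis by (intro bexI[of _ "p * q"]) (auto simp: eval_simps polys_in_mult)
    qed
    show "\<exists>g. ?P g \<and> g x \<noteq> g y" if "x \<in> S \<and> y \<in> S \<and> x \<noteq> y" for x y
    proof -
      from that have "restr V x \<noteq> restr V y" using S(2) by metis
      then obtain i where "i \<in> V" "vec_nth x i \<noteq> vec_nth y i" by (auto simp: restr_eq_iff)
      then show ?thesis
        by (intro exI[of _ "\<lambda>z. eval (vec_nth z) (Var i)"] conjI bexI[of _ "Var i"] refl)
          (auto intro: polys_in_Var)
    qed
  qed
  then show ?thesis by blast
qed

text \<open>
  On the compact set where \<open>g \<le> 0\<close> the function \<open>d\<close> has no zero, hence is bounded away from
  \<open>0\<close>, and a large multiple of it outweighs \<open>g\<close>.
\<close>

lemma penalised_lower_bound: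
  fixes g d :: "'a::metric_space \<Rightarrow> real"
  assumes C: "compact C" and g: "continuous_on C g" and d: "continuous_on C d"
    and d_nonneg: "\<And>x. x \<in> C \<Longrightarrow> 0 \<le> d x"
    and pos: "\<And>x. x \<in> C \<Longrightarrow> d x = 0 \<Longrightarrow> 0 < g x"
  obtains k e where "0 \<le> k" "0 < e" "\<And>x. x \<in> C \<Longrightarrow> e \<le> g x + k * d x"
proof -
  define N where "N = {x \<in> C. g x \<le> 0}"
  have "closed N"
    unfolding N_def
    by (intro continuous_on_closed_Collect_le g continuous_on_const compact_imp_closed C)
  then have N: "compact N"
    using compact_Int_closed[OF C, of N] by (simp add: N_def Int_def conj_commute cong: conj_cong)
  have "\<exists>\<delta>>0. \<forall>x\<in>N. \<delta> \<le> d x"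
  proof (cases "N = {}")
    case False
    have "continuous_on N d" by (rule continuous_on_subset[OF d]) (auto simp: N_def)
    then obtain x where x: "x \<in> N" "\<forall>y\<in>N. d x \<le> d y"
      using continuous_attains_inf[OF N False] by blast
    moreover have "0 < d x"
      using x(1) d_nonneg[of x] pos[of x] by (force simp: N_def)
    ultimately show ?thesis by blast
  qed (auto intro: exI[of _ 1])
  then obtain \<delta> where \<delta>: "0 < \<delta>" "\<And>x. x \<in> N \<Longrightarrow> \<delta> \<le> d x" by blast
  have "bounded (g ` C)" using compact_continuous_image[OF g C] by (rule compact_imp_bounded)
  then obtain B where B: "0 < B" "\<And>x. x \<in> C \<Longrightarrow> \<bar>g x\<bar> < B"
    unfolding bounded_pos_less by auto
  define k where "k = B / \<delta>"
  have k: "0 \<le> k" using B \<delta> by (simp add: k_def)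
  have u_pos: "0 < g x + k * d x" if x: "x \<in> C" for x
  proof (cases "x \<in> N")
    case True
    have "B = k * \<delta>" using \<delta> by (simp add: k_def)
    also have "\<dots> \<le> k * d x" using \<delta>(2)[OF True] k by (rule mult_left_mono)
    finally show ?thesis using B(2)[OF x] by simp
  next
    case False
    moreover have "0 \<le> k * d x" using k d_nonneg[OF x] by simp
    ultimately show ?thesis using x by (simp add: N_def)
  qed
  show ?thesis
  proof (cases "C = {}")
    case True
    then show ?thesis using that[of 0 1] by simp
  next
    case False
    have "continuous_on C (\<lambda>x. g x + k * d x)" by (intro continuous_intros g d)
    then obtain x where "x \<in> C" "\<forall>y\<in>C. g x + k * d x \<le> g y + k * d y"
      using continuous_attains_inf[OF C False] by blast
    then show ?thesis using that[OF k u_pos] by blast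
  qed
qed

text \<open>
  The polynomial has to lie strictly between \<open>- h\<close> on \<open>L\<close> and \<open>g\<close> on \<open>K\<close>, as functions of the
  coordinates in \<open>V\<close>.  The best upper bound in terms of these coordinates, the minimum of \<open>g\<close> over
  the fibre, is only lower semicontinuous.  Replacing the condition to lie in the fibre by a
  penalty \<open>k * dist\<close> gives a Lipschitz function, and for large \<open>k\<close> a uniform gap to \<open>- h\<close> remains.
\<close>

lemma interpolating_polynomial:
  fixes K L :: "(real ^ 'n::finite) set" and g h :: "real ^ 'n \<Rightarrow> real"
  assumes K: "compact K" and L: "compact L"
    and g: "continuous_on K g" and h: "continuous_on L h"
    and pos: "\<And>a b. a \<in> K \<Longrightarrow> b \<in> L \<Longrightarrow> restr V a = restr V b \<Longrightarrow> 0 < g a + h b"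
  shows "\<exists>p\<in>polys_in V. (\<forall>a\<in>K. 0 < g a - eval (vec_nth a) p) \<and> (\<forall>b\<in>L. 0 < h b + eval (vec_nth b) p)"
proof (cases "K = {}")
  case True
  have "bounded (h ` L)" using compact_continuous_image[OF h L] by (rule compact_imp_bounded)
  then obtain B where "\<forall>b\<in>L. \<bar>h b\<bar> \<le> B" by (auto simp: bounded_iff)
  then have "\<forall>b\<in>L. 0 < h b + eval (vec_nth b) (Const (B + 1))" by force
  then show ?thesis using True polys_in_Const by blast
next
  case False
  have "compact (K \<times> L)" using K L by (rule compact_Times)
  moreover have "continuous_on (K \<times> L) (\<lambda>(a, b). g a + h b)"
    using g h by (auto simp: case_prod_beta intro!: continuous_intros continuous_on_compose2[OF g] continuous_on_compose2[OF h])
  moreover have "continuous_on (K \<times> L) (\<lambda>(a, b). dist (restr V a) (restr V b))"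
    by (auto simp: case_prod_beta intro!: continuous_intros continuous_on_compose2[OF continuous_on_restr[of UNIV]])
  ultimately obtain k e where k: "0 \<le> k" and e: "0 < e"
    and le: "\<And>a b. a \<in> K \<Longrightarrow> b \<in> L \<Longrightarrow> e \<le> g a + h b + k * dist (restr V a) (restr V b)"
    by (rule penalised_lower_bound) (use pos in auto)
  have "bounded (g ` K)" using compact_continuous_image[OF g K] by (rule compact_imp_bounded)
  then obtain B where B: "\<forall>a\<in>K. \<bar>g a\<bar> \<le> B" by (auto simp: bounded_iff)
  (* w is Lipschitz, at most g on K, and at least e - h on L; w - e / 2 leaves room on both sides *)
  define w where "w z = (INF a\<in>K. g a + k * dist (restr V a) z)" for z
  have bdd: "bdd_below ((\<lambda>a. g a + k * dist (restr V a) z) ` K)" for z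
    using B k by (intro bdd_belowI[of _ "- B"]) (force intro: add_increasing2)
  have w_le: "w z \<le> g a + k * dist (restr V a) z" if "a \<in> K" for a z
    unfolding w_def using that by (rule cINF_lower[OF bdd])
  have w_lip: "w z \<le> w z' + k * dist z z'" for z z'
  proof -
    have "w z - k * dist z z' \<le> w z'"
      unfolding w_def[of z']
    proof (rule cINF_greatest[OF False])
      fix a assume "a \<in> K"
      have "k * dist (restr V a) z \<le> k * (dist (restr V a) z' + dist z z')"
        using k by (intro mult_left_mono dist_triangle2)
      then show "w z - k * dist z z' \<le> g a + k * dist (restr V a) z'"
        using w_le[OF \<open>a \<in> K\<close>, of z] by (simp add: distrib_left)
    qed
    then show ?thesis by simp
  qed
  have w: "continuous_on S w" for S
  proof (rule lipschitz_on_continuous_on)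
    show "k-lipschitz_on S w"
    proof (rule lipschitz_onI)
      show "dist (w x) (w y) \<le> k * dist x y" for x y
        using w_lip[of x y] w_lip[of y x] by (simp add: dist_real_def dist_commute)
    qed (rule k)
  qed
  have S: "compact (restr V ` (K \<union> L))"
    using K L by (intro compact_continuous_image continuous_on_restr compact_Un)
  have "\<exists>p\<in>polys_in V. \<forall>z\<in>restr V ` (K \<union> L). \<bar>(w z - e / 2) - eval (vec_nth z) p\<bar> < e / 2"
    using e by (intro polys_in_dense[OF S] continuous_intros w) (auto simp: restr_idem)
  then obtain p where p: "p \<in> polys_in V"
    and approx: "\<And>x. x \<in> K \<union> L \<Longrightarrow> \<bar>w (restr V x) - e / 2 - eval (vec_nth x) p\<bar> < e / 2"
    by (auto simp: eval_restr)
  have "0 < g a - eval (vec_nth a) p" if "a \<in> K" for a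
    using approx[of a] w_le[OF that, of "restr V a"] that by (simp add: abs_if split: if_splits)
  moreover have "0 < h b + eval (vec_nth b) p" if "b \<in> L" for b
  proof -
    have "e - h b \<le> w (restr V b)"
      unfolding w_def using le[OF _ that] by (intro cINF_greatest[OF False]) (simp add: algebra_simps)
    then show ?thesis using approx[of b] that by (simp add: abs_if split: if_splits)
  qed
  ultimately show ?thesis using p by blast
qed

lemma bounded_componentwise:
  fixes S :: "(real ^ 'n::finite) set"
  assumes "\<And>i. \<exists>B. \<forall>x\<in>S. \<bar>vec_nth x i\<bar> \<le> B"
  shows "bounded S"
proof -
  obtain B where B: "\<And>i x. x \<in> S \<Longrightarrow> \<bar>vec_nth x i\<bar> \<le> B i" using assms by metis
  have "norm x \<le> (\<Sum>i\<in>UNIV. B i)" if "x \<in> S" for x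
    using norm_le_l1_cart[of x] B[OF that] by (meson order_trans sum_mono)
  then show ?thesis by (auto simp: bounded_iff)
qed

text \<open>
  Induction on the number of blocks.  A point of the first \<open>t\<close> sets and a point of the last one
  that agree in the shared variables \<open>V\<close> can be glued to a point of all the sets, where the sum is
  positive.  So there is a polynomial \<open>p\<close> in \<open>V\<close> that can be subtracted from the first \<open>t\<close> summands
  and added to the last one, making both parts positive.  By the running intersection property all
  variables of \<open>p\<close> occur in one of the first \<open>t\<close> blocks, whose summand takes the change.
\<close>

theorem sparse_positive_decomposition:
  fixes I :: "nat \<Rightarrow> 'n::finite set" and K :: "nat \<Rightarrow> (real ^ 'n) set"
  assumes "\<And>l. l \<in> {1..t} \<Longrightarrow> closed (K l)"
    and "\<And>l x y. l \<in> {1..t} \<Longrightarrow> x \<in> K l \<Longrightarrow> restr (I l) x = restr (I l) y \<Longrightarrow> y \<in> K l"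
    and "\<And>l i. l \<in> {1..t} \<Longrightarrow> i \<in> I l \<Longrightarrow> \<exists>B. \<forall>x\<in>K l. \<bar>vec_nth x i\<bar> \<le> B"
    and "\<And>l. l \<in> {2..t} \<Longrightarrow> \<exists>k\<in>{1..<l}. I l \<inter> (\<Union>j\<in>{1..<l}. I j) \<subseteq> I k"
    and "\<And>l. l \<in> {1..t} \<Longrightarrow> F l \<in> polys_in (I l)"
    and "\<And>x. x \<in> (\<Inter>l\<in>{1..t}. K l) \<Longrightarrow> 0 < (\<Sum>l\<in>{1..t}. eval (vec_nth x) (F l))"
  shows "\<exists>h. (\<Sum>l\<in>{1..t}. h l) = (\<Sum>l\<in>{1..t}. F l) \<and>
    (\<forall>l\<in>{1..t}. h l \<in> polys_in (I l) \<and> (\<forall>x\<in>K l. 0 < eval (vec_nth x) (h l)))"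
  using assms
proof (induction t arbitrary: F)
  case 0
  then show ?case by simp
next
  case (Suc t)
  note closed = Suc.prems(1) and saturated = Suc.prems(2) and bdd = Suc.prems(3)
    and rip = Suc.prems(4) and F = Suc.prems(5) and pos = Suc.prems(6)
  show ?case
  proof (cases "t = 0")
    case True
    then show ?thesis using F pos by (intro exI[of _ F]) auto
  next
    case False
    define U where "U = (\<Union>l\<in>{1..t}. I l)"
    define V where "V = U \<inter> I (Suc t)"
    define A where "A = {x \<in> (\<Inter>l\<in>{1..t}. K l). restr U x = x}"
    define L where "L = {x \<in> K (Suc t). restr (I (Suc t)) x = x}"
    have "\<exists>k\<in>{1..<Suc t}. I (Suc t) \<inter> (\<Union>j\<in>{1..<Suc t}. I j) \<subseteq> I k"
      using rip[of "Suc t"] False by simp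
    then obtain k where k: "k \<in> {1..t}" and "V \<subseteq> I k"
      unfolding V_def U_def atLeastLessThanSuc_atLeastAtMost Int_commute[of "I (Suc t)"] by blast
    have fixed: "closed {x :: real ^ 'n. restr W x = x}" for W
      by (intro closed_Collect_eq continuous_on_restr continuous_on_id)
    have zero: "vec_nth x i = 0" if "restr W x = x" "i \<notin> W" for W and x :: "real ^ 'n" and i
      using that by (metis restr_nth)
    have "closed A"
    proof -
      have "A = (\<Inter>l\<in>{1..t}. K l) \<inter> {x. restr U x = x}" by (auto simp: A_def)
      then show ?thesis using closed fixed by (auto intro!: closed_Int closed_INT)
    qed
    moreover have "bounded A"
    proof (rule bounded_componentwise)
      fix i
      show "\<exists>B. \<forall>x\<in>A. \<bar>vec_nth x i\<bar> \<le> B"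
      proof (cases "i \<in> U")
        case True
        then obtain l where l: "l \<in> {1..t}" "i \<in> I l" by (auto simp: U_def)
        then obtain B where "\<forall>x\<in>K l. \<bar>vec_nth x i\<bar> \<le> B" using bdd[of l i] by auto
        then show ?thesis using l by (intro exI[of _ B]) (auto simp: A_def)
      qed (auto simp: A_def zero)
    qed
    ultimately have A: "compact A" by (simp add: compact_eq_bounded_closed)
    have "closed L"
    proof -
      have "L = K (Suc t) \<inter> {x. restr (I (Suc t)) x = x}" by (auto simp: L_def)
      then show ?thesis using closed[of "Suc t"] fixed by (auto intro!: closed_Int)
    qed
    moreover have "bounded L"
    proof (rule bounded_componentwise)
      fix i
      show "\<exists>B. \<forall>x\<in>L. \<bar>vec_nth x i\<bar> \<le> B"
      proof (cases "i \<in> I (Suc t)")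
        case True
        then obtain B where "\<forall>x\<in>K (Suc t). \<bar>vec_nth x i\<bar> \<le> B" using bdd[of "Suc t" i] by auto
        then show ?thesis by (intro exI[of _ B]) (auto simp: L_def)
      qed (auto simp: L_def zero)
    qed
    ultimately have L: "compact L" by (simp add: compact_eq_bounded_closed)
    have "\<exists>p\<in>polys_in V. (\<forall>a\<in>A. 0 < (\<Sum>l\<in>{1..t}. eval (vec_nth a) (F l)) - eval (vec_nth a) p) \<and>
        (\<forall>b\<in>L. 0 < eval (vec_nth b) (F (Suc t)) + eval (vec_nth b) p)"
    proof (rule interpolating_polynomial[OF A L])
      fix a b assume a: "a \<in> A" and b: "b \<in> L" and ab: "restr V a = restr V b"
      (* x glues a and b, which agree on the shared variables, to one point of all the sets *)
      define x where "x = (\<chi> i. if i \<in> U then vec_nth a i else vec_nth b i)"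
      have xa: "vec_nth x i = vec_nth a i" if "l \<in> {1..t}" "i \<in> I l" for l i
        using that by (auto simp: x_def U_def)
      have xb: "vec_nth x i = vec_nth b i" if "i \<in> I (Suc t)" for i
        using that ab by (auto simp: x_def V_def restr_eq_iff)
      have "x \<in> K l" if "l \<in> {1..t}" for l
        using saturated[of l a x] a that xa by (auto simp: A_def restr_eq_iff)
      moreover have "x \<in> K (Suc t)"
        using saturated[of "Suc t" b x] b xb by (auto simp: L_def restr_eq_iff)
      ultimately have "0 < (\<Sum>l\<in>{1..Suc t}. eval (vec_nth x) (F l))"
        by (intro pos) (auto simp: le_Suc_eq)
      also have "\<dots> = (\<Sum>l\<in>{1..t}. eval (vec_nth x) (F l)) + eval (vec_nth x) (F (Suc t))"
        by simp
      also have "(\<Sum>l\<in>{1..t}. eval (vec_nth x) (F l)) = (\<Sum>l\<in>{1..t}. eval (vec_nth a) (F l))"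
        by (intro sum.cong refl eval_cong[OF F]) (auto intro: xa)
      also have "eval (vec_nth x) (F (Suc t)) = eval (vec_nth b) (F (Suc t))"
        by (intro eval_cong[OF F]) (auto intro: xb)
      finally show "0 < (\<Sum>l\<in>{1..t}. eval (vec_nth a) (F l)) + eval (vec_nth b) (F (Suc t))" .
    qed (intro continuous_intros)+
    then obtain p where p: "p \<in> polys_in V"
      and pA: "\<And>a. a \<in> A \<Longrightarrow> 0 < (\<Sum>l\<in>{1..t}. eval (vec_nth a) (F l)) - eval (vec_nth a) p"
      and pL: "\<And>b. b \<in> L \<Longrightarrow> 0 < eval (vec_nth b) (F (Suc t)) + eval (vec_nth b) p"
      by blast
    have pk: "p \<in> polys_in (I k)" and pU: "p \<in> polys_in U" and pt: "p \<in> polys_in (I (Suc t))"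
      using p \<open>V \<subseteq> I k\<close> by (auto simp: V_def intro: polys_in_mono)
    (* all variables of p lie in block k, whose summand can absorb the correction *)
    define F' where "F' = F(k := F k - p)"
    have F'_sum: "(\<Sum>l\<in>{1..t}. F' l) = (\<Sum>l\<in>{1..t}. F l) - p"
    proof -
      have "(\<Sum>l\<in>{1..t}. F' l) = (\<Sum>l\<in>{1..t}. F l - (if l = k then p else 0))"
        by (intro sum.cong) (auto simp: F'_def)
      then show ?thesis using k by (simp add: sum_subtractf)
    qed
    have "\<exists>h. (\<Sum>l\<in>{1..t}. h l) = (\<Sum>l\<in>{1..t}. F' l) \<and>
      (\<forall>l\<in>{1..t}. h l \<in> polys_in (I l) \<and> (\<forall>x\<in>K l. 0 < eval (vec_nth x) (h l)))"
    proof (rule Suc.IH)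
      show "F' l \<in> polys_in (I l)" if "l \<in> {1..t}" for l
        using that F[of l] pk by (auto simp: F'_def intro: poly.diff_in)
      show "0 < (\<Sum>l\<in>{1..t}. eval (vec_nth x) (F' l))" if x: "x \<in> (\<Inter>l\<in>{1..t}. K l)" for x
      proof -
        have Il: "I l \<subseteq> U" if "l \<in> {1..t}" for l using that by (auto simp: U_def)
        have "restr U x \<in> K l" if "l \<in> {1..t}" for l
        proof (rule saturated[of l x])
          show "restr (I l) x = restr (I l) (restr U x)"
            using Il[OF that] by (auto simp: restr_eq_iff)
        qed (use that x in auto)
        then have "restr U x \<in> A" by (simp add: A_def restr_idem)
        from pA[OF this] have "0 < eval (vec_nth (restr U x)) ((\<Sum>l\<in>{1..t}. F l) - p)"
          by (simp add: eval_simps)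
        also have "\<dots> = eval (vec_nth x) ((\<Sum>l\<in>{1..t}. F l) - p)"
          by (intro eval_restr poly.diff_in polys_in_sum pU) (auto intro: polys_in_mono[OF F Il])
        finally show ?thesis unfolding F'_sum[symmetric] eval_sum .
      qed
    qed (use closed saturated bdd rip in auto)
    then obtain h where h: "(\<Sum>l\<in>{1..t}. h l) = (\<Sum>l\<in>{1..t}. F' l)"
      "\<And>l. l \<in> {1..t} \<Longrightarrow> h l \<in> polys_in (I l)"
      "\<And>l x. l \<in> {1..t} \<Longrightarrow> x \<in> K l \<Longrightarrow> 0 < eval (vec_nth x) (h l)"
      by blast
    define h' where "h' = h(Suc t := F (Suc t) + p)"
    have "(\<Sum>l\<in>{1..Suc t}. h' l) = (\<Sum>l\<in>{1..t}. h l) + (F (Suc t) + p)"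
      by (simp add: h'_def)
    then have "(\<Sum>l\<in>{1..Suc t}. h' l) = (\<Sum>l\<in>{1..Suc t}. F l)"
      using h(1) F'_sum by simp
    moreover have "h' l \<in> polys_in (I l)" if "l \<in> {1..Suc t}" for l
      using that h(2)[of l] by (auto simp: h'_def le_Suc_eq intro!: polys_in_add pt F)
    moreover have "0 < eval (vec_nth x) (h' l)" if l: "l \<in> {1..Suc t}" and x: "x \<in> K l" for l x
    proof (cases "l = Suc t")
      case True
      have "restr (I (Suc t)) x \<in> L"
        using saturated[of "Suc t" x "restr (I (Suc t)) x"] x True by (auto simp: L_def restr_idem)
      from pL[OF this] show ?thesis
        using True pt F[of "Suc t"] by (simp add: h'_def eval_simps eval_restr)
    qed (use l x h(3)[of l x] in \<open>auto simp: h'_def\<close>)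
    ultimately show ?thesis by blast
  qed
qed

text \<open>
  The nonnegativity sets of the modules satisfy the assumptions of the decomposition theorem, and
  \<open>putinar\<close> applies to each of the positive summands.
\<close>

theorem sparse_putinar:
  fixes I :: "nat \<Rightarrow> 'n::finite set" and M :: "nat \<Rightarrow> 'n rpoly set"
  assumes M: "\<And>l. l \<in> {1..t} \<Longrightarrow> poly.quadratic_module (I l) (M l)"
    and M_in: "\<And>l. l \<in> {1..t} \<Longrightarrow> M l \<subseteq> polys_in (I l)"
    and arch: "\<And>l. l \<in> {1..t} \<Longrightarrow> \<exists>C. Const C - (\<Sum>i\<in>I l. Var i ^ 2) \<in> M l"
    and rip: "\<And>l. l \<in> {2..t} \<Longrightarrow> \<exists>k\<in>{1..<l}. I l \<inter> (\<Union>j\<in>{1..<l}. I j) \<subseteq> I k"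
    and F: "\<And>l. l \<in> {1..t} \<Longrightarrow> F l \<in> polys_in (I l)"
    and pos: "\<And>x. (\<And>l m. l \<in> {1..t} \<Longrightarrow> m \<in> M l \<Longrightarrow> 0 \<le> eval (vec_nth x) m) \<Longrightarrow>
      0 < eval (vec_nth x) (\<Sum>l\<in>{1..t}. F l)"
  shows "\<exists>m. (\<forall>l\<in>{1..t}. m l \<in> M l) \<and> (\<Sum>l\<in>{1..t}. F l) = (\<Sum>l\<in>{1..t}. m l)"
proof -
  define K where "K l = {x. \<forall>m\<in>M l. 0 \<le> eval (vec_nth x) m}" for l
  have "\<exists>h. (\<Sum>l\<in>{1..t}. h l) = (\<Sum>l\<in>{1..t}. F l) \<and>
    (\<forall>l\<in>{1..t}. h l \<in> polys_in (I l) \<and> (\<forall>x\<in>K l. 0 < eval (vec_nth x) (h l)))"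
  proof (rule sparse_positive_decomposition[OF _ _ _ rip F])
    fix l assume l: "l \<in> {1..t}"
    have "K l = (\<Inter>m\<in>M l. {x. 0 \<le> eval (vec_nth x) m})" by (auto simp: K_def)
    also have "closed \<dots>" by (intro closed_INT ballI closed_Collect_le continuous_intros)
    finally show "closed (K l)" .
    show "y \<in> K l" if "x \<in> K l" "restr (I l) x = restr (I l) y" for x y
    proof -
      have "eval (vec_nth x) m = eval (vec_nth y) m" if "m \<in> M l" for m
        using that M_in[OF l] \<open>restr (I l) x = restr (I l) y\<close>
        by (intro eval_cong[of m "I l"]) (auto simp: restr_eq_iff)
      then show ?thesis using that by (simp add: K_def)
    qed
    obtain C where C: "Const C - (\<Sum>i\<in>I l. Var i ^ 2) \<in> M l" using arch[OF l] by blast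
    show "\<exists>B. \<forall>x\<in>K l. \<bar>vec_nth x i\<bar> \<le> B" if i: "i \<in> I l" for i
    proof (intro exI[of _ "sqrt C"] ballI)
      fix x assume "x \<in> K l"
      then have "0 \<le> eval (vec_nth x) (Const C - (\<Sum>i\<in>I l. Var i ^ 2))"
        using C unfolding K_def by blast
      then have "(\<Sum>i\<in>I l. (vec_nth x i)\<^sup>2) \<le> C" by (simp add: eval_simps)
      moreover have "(vec_nth x i)\<^sup>2 \<le> (\<Sum>i\<in>I l. (vec_nth x i)\<^sup>2)"
        using i by (intro member_le_sum) auto
      ultimately have "sqrt ((vec_nth x i)\<^sup>2) \<le> sqrt C" by (intro real_sqrt_le_mono) simp
      then show "\<bar>vec_nth x i\<bar> \<le> sqrt C" by simp
    qed
  next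
    fix x assume "x \<in> (\<Inter>l\<in>{1..t}. K l)"
    then show "0 < (\<Sum>l\<in>{1..t}. eval (vec_nth x) (F l))"
      using pos[of x] by (auto simp: K_def eval_sum)
  qed
  then obtain h where h: "(\<Sum>l\<in>{1..t}. h l) = (\<Sum>l\<in>{1..t}. F l)"
    and h_in: "\<And>l. l \<in> {1..t} \<Longrightarrow> h l \<in> polys_in (I l)"
    and h_pos: "\<And>l x. l \<in> {1..t} \<Longrightarrow> x \<in> K l \<Longrightarrow> 0 < eval (vec_nth x) (h l)"
    by blast
  have "h l \<in> M l" if l: "l \<in> {1..t}" for l
  proof -
    obtain C where "Const C - (\<Sum>i\<in>I l. Var i ^ 2) \<in> M l" using arch[OF l] by blast
    then show ?thesis
    proof (rule putinar[OF M[OF l] _ M_in[OF l] h_in[OF l]])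
      fix x :: "'n \<Rightarrow> real" assume "\<And>m. m \<in> M l \<Longrightarrow> 0 \<le> eval x m"
      then have "vec_lambda x \<in> K l" by (simp add: K_def vec_lambda_inverse)
      from h_pos[OF l this] show "0 < eval x (h l)" by (simp add: vec_lambda_inverse)
    qed
  qed
  then show ?thesis using h by metis
qed

section \<open>Integration over y and the quadratic modules of the blocks\<close>

abbreviation moment :: "(real ^ 'm) set \<Rightarrow> (real ^ 'm) measure \<Rightarrow> ('m \<Rightarrow>\<^sub>0 nat) \<Rightarrow> real" where
  "moment Y \<nu> \<beta> \<equiv> set_lebesgue_integral \<nu> Y (\<lambda>y. eval_monom (vec_nth y) \<beta>)"

text \<open>
  Grouping the monomials by their \<open>y\<close>-part is undone here; over a common index set the integral
  is visibly additive.
\<close>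

lemma integral_y_superset:
  assumes "finite S" "Poly_Mapping.keys h \<subseteq> S"
  shows "integral_y Y \<nu> h = (\<Sum>\<mu>\<in>S. Poly_Mapping.single (Poly_Mapping.map_key Inl \<mu>)
    (Poly_Mapping.lookup h \<mu> * moment Y \<nu> (Poly_Mapping.map_key Inr \<mu>)))"
proof -
  have "integral_y Y \<nu> h = (\<Sum>\<mu>\<in>Poly_Mapping.keys h. Poly_Mapping.single (Poly_Mapping.map_key Inl \<mu>)
    (Poly_Mapping.lookup h \<mu> * moment Y \<nu> (Poly_Mapping.map_key Inr \<mu>)))"
    unfolding integral_y_def coeff_y_def sum_distrib_right
    by (subst sum.image_gen[of _ _ "Poly_Mapping.map_key Inr"])
      (auto intro!: sum.cong simp: Const_def mult_single)
  also have "\<dots> = (\<Sum>\<mu>\<in>S. Poly_Mapping.single (Poly_Mapping.map_key Inl \<mu>)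
    (Poly_Mapping.lookup h \<mu> * moment Y \<nu> (Poly_Mapping.map_key Inr \<mu>)))"
    using assms by (intro sum.mono_neutral_left) (auto simp: in_keys_iff)
  finally show ?thesis .
qed

lemma integral_y_single:
  "integral_y Y \<nu> (Poly_Mapping.single \<mu> r) =
    Poly_Mapping.single (Poly_Mapping.map_key Inl \<mu>) (r * moment Y \<nu> (Poly_Mapping.map_key Inr \<mu>))"
  by (subst integral_y_superset[of "{\<mu>}"]) auto

lemma integral_y_zero: "integral_y Y \<nu> 0 = 0"
  by (simp add: integral_y_def)

lemma integral_y_add: "integral_y Y \<nu> (g + h) = integral_y Y \<nu> g + integral_y Y \<nu> h"
proof -
  let ?S = "Poly_Mapping.keys g \<union> Poly_Mapping.keys h"
  have "finite ?S" "Poly_Mapping.keys (g + h) \<subseteq> ?S" using keys_add[of g h] by auto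
  then show ?thesis
    by (simp add: integral_y_superset[of ?S] lookup_add distrib_right single_add sum.distrib)
qed

lemma integral_y_in:
  assumes "h \<in> polys_in (vars_xy I)"
  shows "integral_y Y \<nu> h \<in> polys_in I"
  using assms
  by (induction rule: polys_in_single_induct)
    (auto simp: integral_y_single integral_y_add keys_map_key vars_xy_def intro!: polys_in_single polys_in_add)

lemma map_key_Inr_Var: "Poly_Mapping.map_key Inr (Poly_Mapping.single (Inl v) k) = 0"
  by (rule poly_mapping_eqI) (simp add: map_key.rep_eq lookup_single when_def)

text \<open>
  The polynomial \<open>p'\<close> is \<open>p\<close> read as a polynomial in \<open>(x, y)\<close>.  Stated as an existence, the
  claim only has to be checked for constants and variables.
\<close>

lemma integral_y_pull_out:
  assumes "p \<in> polys_in I"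
  shows "\<exists>p'\<in>polys_in (vars_xy I). \<forall>h. integral_y Y \<nu> (p' * h) = p * integral_y Y \<nu> h"
  using assms
proof (induction rule: polys_in_induct)
  case (Const r)
  have "integral_y Y \<nu> (Const r * h) = Const r * integral_y Y \<nu> h" for h
    using in_polys_in_UNIV[of h]
    by (induction rule: polys_in_single_induct)
      (auto simp: integral_y_single integral_y_add Const_def mult_single distrib_left mult.assoc)
  then show ?case using polys_in_Const by blast
next
  case (Var v)
  have "integral_y Y \<nu> (Var (Inl v) * h) = Var v * integral_y Y \<nu> h" for h
    using in_polys_in_UNIV[of h]
    by (induction rule: polys_in_single_induct)
      (auto simp: integral_y_single integral_y_add Var_def mult_single distrib_left
        map_key_plus map_key_Inr_Var)
  moreover have "Var (Inl v) \<in> polys_in (vars_xy I)"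
    using Var by (auto simp: vars_xy_def intro: polys_in_Var)
  ultimately show ?case by blast
next
  case (add p q)
  then obtain p' q' where "p' \<in> polys_in (vars_xy I)" "q' \<in> polys_in (vars_xy I)"
    "\<forall>h. integral_y Y \<nu> (p' * h) = p * integral_y Y \<nu> h"
    "\<forall>h. integral_y Y \<nu> (q' * h) = q * integral_y Y \<nu> h" by blast
  then show ?case
    by (intro bexI[of _ "p' + q'"]) (auto simp: distrib_right integral_y_add polys_in_add)
next
  case (mult p q)
  then obtain p' q' where "p' \<in> polys_in (vars_xy I)" "q' \<in> polys_in (vars_xy I)"
    "\<forall>h. integral_y Y \<nu> (p' * h) = p * integral_y Y \<nu> h"
    "\<forall>h. integral_y Y \<nu> (q' * h) = q * integral_y Y \<nu> h" by blast
  then show ?case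
    by (intro bexI[of _ "p' * q'"]) (auto simp: mult.assoc polys_in_mult)
qed

lemma eval_monom_case_sum:
  fixes \<mu> :: "('n::finite + 'm::finite) \<Rightarrow>\<^sub>0 nat"
  shows "eval_monom (case_sum x y) \<mu> =
    eval_monom x (Poly_Mapping.map_key Inl \<mu>) * eval_monom y (Poly_Mapping.map_key Inr \<mu>)"
proof -
  have "eval_monom (case_sum x y) \<mu> = (\<Prod>v\<in>UNIV <+> UNIV. case_sum x y v ^ Poly_Mapping.lookup \<mu> v)"
    by (subst eval_monom_superset[of UNIV]) auto
  also have "\<dots> = (\<Prod>v\<in>UNIV. x v ^ Poly_Mapping.lookup \<mu> (Inl v)) * (\<Prod>v\<in>UNIV. y v ^ Poly_Mapping.lookup \<mu> (Inr v))"
    by (subst prod.Plus) auto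
  finally show ?thesis
    by (simp add: eval_monom_superset[of UNIV] map_key.rep_eq)
qed

lemma set_integrable_monom:
  fixes \<nu> :: "(real ^ 'm::finite) measure"
  assumes Y: "compact Y" and sets: "sets \<nu> = sets borel"
    and fin: "\<And>h :: 'm rpoly. (\<integral>\<^sup>+y\<in>Y. ennreal \<bar>eval (vec_nth y) h\<bar> \<partial>\<nu>) < \<infinity>"
  shows "set_integrable \<nu> Y (\<lambda>y. eval_monom (vec_nth y) \<beta>)"
proof -
  have eq: "eval_monom (vec_nth y) \<beta> = eval (vec_nth y) (Poly_Mapping.single \<beta> 1)" for y :: "real ^ 'm"
    by (simp add: eval_single)
  have "(\<lambda>y. eval (vec_nth y) h) \<in> borel_measurable borel" for h :: "'m rpoly"
    by (intro borel_measurable_continuous_onI continuous_intros)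
  moreover have "Y \<in> sets borel" using Y by (simp add: borel_compact)
  ultimately have meas: "(\<lambda>y. indicator Y y *\<^sub>R eval (vec_nth y) h) \<in> borel_measurable \<nu>" for h :: "'m rpoly"
    unfolding measurable_cong_sets[OF sets refl]
    by (intro borel_measurable_scaleR borel_measurable_indicator)
  show ?thesis
    unfolding set_integrable_def eq
  proof (rule integrableI_bounded[OF meas])
    have "(\<integral>\<^sup>+y. ennreal (norm (indicator Y y *\<^sub>R eval (vec_nth y) (Poly_Mapping.single \<beta> 1))) \<partial>\<nu>)
      = (\<integral>\<^sup>+y\<in>Y. ennreal \<bar>eval (vec_nth y) (Poly_Mapping.single \<beta> 1)\<bar> \<partial>\<nu>)"
      by (intro nn_integral_cong) (auto simp: indicator_def)
    then show "(\<integral>\<^sup>+y. ennreal (norm (indicator Y y *\<^sub>R eval (vec_nth y) (Poly_Mapping.single \<beta> 1))) \<partial>\<nu>) < \<infinity>"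
      using fin[of "Poly_Mapping.single \<beta> 1"] by simp
  qed
qed

text \<open>
  Both sides are additive in \<open>h\<close>, and on a monomial the factor in \<open>x\<close> leaves the integral.
\<close>

lemma eval_integral_y:
  fixes \<nu> :: "(real ^ 'm::finite) measure" and x :: "real ^ 'n::finite"
  assumes monom: "\<And>\<beta>. set_integrable \<nu> Y (\<lambda>y. eval_monom (vec_nth y) \<beta>)"
  shows "eval (vec_nth x) (integral_y Y \<nu> h) = set_lebesgue_integral \<nu> Y (\<lambda>y. eval_xy x y h)"
proof -
  have "set_integrable \<nu> Y (\<lambda>y. eval_xy x y h) \<and>
    eval (vec_nth x) (integral_y Y \<nu> h) = set_lebesgue_integral \<nu> Y (\<lambda>y. eval_xy x y h)"
    using in_polys_in_UNIV[of h]
  proof (induction rule: polys_in_single_induct)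
    case (single \<mu> r)
    have eq: "eval_xy x y (Poly_Mapping.single \<mu> r) =
        (r * eval_monom (vec_nth x) (Poly_Mapping.map_key Inl \<mu>)) *
          eval_monom (vec_nth y) (Poly_Mapping.map_key Inr \<mu>)" for y :: "real ^ 'm"
      by (simp add: eval_xy_def eval_single eval_monom_case_sum)
    show ?case
      unfolding eq using monom
      by (auto simp: integral_y_single eval_single)
  next
    case (add p q)
    have "eval_xy x y (p + q) = eval_xy x y p + eval_xy x y q" for y :: "real ^ 'm"
      by (simp add: eval_xy_def eval_add)
    then show ?case using add by (auto simp: integral_y_add eval_add)
  qed
  then show ?thesis ..
qed

text \<open>
  In this form stacking two factors \<open>T\<close> and \<open>T'\<close> is the concatenation of their index ranges.
\<close>

lemma sos_mats_iff:
  "S \<in> sos_mats V r \<longleftrightarrow> S \<in> carrier_mat r r \<and>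
    (\<exists>(l::nat) T. (\<forall>k<l. \<forall>i<r. T k i \<in> polys_in V) \<and>
      (\<forall>i<r. \<forall>j<r. S $$ (i, j) = (\<Sum>k<l. T k i * T k j)))" (is "?lhs \<longleftrightarrow> ?rhs")
proof
  assume ?lhs
  then obtain T l where S: "S = transpose_mat T * T" and T: "T \<in> carrier_mat l r"
    and in_V: "elements_mat T \<subseteq> polys_in V" by (auto simp: sos_mats_def)
  have "\<forall>k<l. \<forall>i<r. T $$ (k, i) \<in> polys_in V" using in_V T by blast
  moreover have "\<forall>i<r. \<forall>j<r. S $$ (i, j) = (\<Sum>k<l. T $$ (k, i) * T $$ (k, j))"
    using T by (auto simp: S scalar_prod_def lessThan_atLeast0 intro!: sum.cong)
  moreover have "S \<in> carrier_mat r r" using T by (simp add: S)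
  ultimately show ?rhs by (intro conjI exI[of _ l] exI[of _ "\<lambda>k i. T $$ (k, i)"])
next
  assume ?rhs
  then obtain l :: nat and T where S: "S \<in> carrier_mat r r"
    and T: "\<forall>k<l. \<forall>i<r. T k i \<in> polys_in V"
    and eq: "\<forall>i<r. \<forall>j<r. S $$ (i, j) = (\<Sum>k<l. T k i * T k j)" by blast
  define T' where "T' = mat l r (\<lambda>(k, i). T k i)"
  have "S = transpose_mat T' * T'"
    using S eq by (intro eq_matI) (auto simp: T'_def scalar_prod_def lessThan_atLeast0 intro!: sum.cong)
  moreover have "T' \<in> carrier_mat l r" by (simp add: T'_def)
  moreover have "elements_mat T' \<subseteq> polys_in V" using T by (auto simp: T'_def)
  ultimately show ?lhs by (auto simp: sos_mats_def)
qed

lemma sum_lessThan_add_split: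
  "(\<Sum>k<l + l'. if k < l then f k else g (k - l)) = (\<Sum>k<l. f k) + (\<Sum>k<l'. g k)"
  for l l' :: nat and f g :: "nat \<Rightarrow> 'a::comm_monoid_add"
  by (induction l') (auto simp: add.assoc)

lemma sos_mats_add:
  assumes "A \<in> sos_mats V r" "B \<in> sos_mats V r"
  shows "A + B \<in> sos_mats V r"
proof -
  obtain l :: nat and T where A: "A \<in> carrier_mat r r" "\<forall>k<l. \<forall>i<r. T k i \<in> polys_in V"
    "\<forall>i<r. \<forall>j<r. A $$ (i, j) = (\<Sum>k<l. T k i * T k j)"
    using assms(1) unfolding sos_mats_iff by blast
  obtain l' :: nat and T' where B: "B \<in> carrier_mat r r" "\<forall>k<l'. \<forall>i<r. T' k i \<in> polys_in V"
    "\<forall>i<r. \<forall>j<r. B $$ (i, j) = (\<Sum>k<l'. T' k i * T' k j)"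
    using assms(2) unfolding sos_mats_iff by blast
  define U where "U k i = (if k < l then T k i else T' (k - l) i)" for k i
  have "(\<Sum>k<l + l'. U k i * U k j) = (\<Sum>k<l. T k i * T k j) + (\<Sum>k<l'. T' k i * T' k j)" for i j
    unfolding sum_lessThan_add_split[symmetric] by (intro sum.cong) (auto simp: U_def)
  then have "\<forall>i<r. \<forall>j<r. (A + B) $$ (i, j) = (\<Sum>k<l + l'. U k i * U k j)"
    using A B by simp
  moreover have "\<forall>k<l + l'. \<forall>i<r. U k i \<in> polys_in V"
    using A B by (auto simp: U_def)
  moreover have "A + B \<in> carrier_mat r r" using A B by simp
  ultimately show ?thesis unfolding sos_mats_iff by blast
qed

lemma sos_mats_square_smult:
  assumes p: "p \<in> polys_in V" and A: "A \<in> sos_mats V r"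
  shows "p\<^sup>2 \<cdot>\<^sub>m A \<in> sos_mats V r"
proof -
  obtain l :: nat and T where *: "A \<in> carrier_mat r r" "\<forall>k<l. \<forall>i<r. T k i \<in> polys_in V"
    "\<forall>i<r. \<forall>j<r. A $$ (i, j) = (\<Sum>k<l. T k i * T k j)"
    using A unfolding sos_mats_iff by blast
  have "\<forall>i<r. \<forall>j<r. (p\<^sup>2 \<cdot>\<^sub>m A) $$ (i, j) = (\<Sum>k<l. (p * T k i) * (p * T k j))"
    using * by (auto simp: sum_distrib_left power2_eq_square algebra_simps)
  moreover have "\<forall>k<l. \<forall>i<r. p * T k i \<in> polys_in V" using * p by (auto intro: polys_in_mult)
  ultimately show ?thesis
    unfolding sos_mats_iff using *(1) smult_carrier_mat[OF *(1)]
    by (intro conjI exI[of _ l] exI[of _ "\<lambda>k i. p * T k i"])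
qed

lemma zero_in_sos_mats: "0\<^sub>m r r \<in> sos_mats V r"
  unfolding sos_mats_iff by (intro conjI exI[of _ "0::nat"]) auto

lemma sos_mats_outer_product:
  assumes "\<And>i. i < r \<Longrightarrow> u i \<in> polys_in V"
  shows "mat r r (\<lambda>(i, j). u i * u j) \<in> sos_mats V r"
  unfolding sos_mats_iff using assms
  by (intro conjI exI[of _ "1::nat"] exI[of _ "\<lambda>k. u"]) auto

lemma sos_mats_in: "A \<in> sos_mats V r \<Longrightarrow> i < r \<Longrightarrow> j < r \<Longrightarrow> A $$ (i, j) \<in> polys_in V"
  unfolding sos_mats_iff by (auto intro!: polys_in_sum polys_in_mult)

lemma sos_mats_carrier: "A \<in> sos_mats V r \<Longrightarrow> A \<in> carrier_mat r r"
  unfolding sos_mats_iff by blast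

lemma sos_polys_add: "\<sigma> \<in> sos_polys V \<Longrightarrow> \<tau> \<in> sos_polys V \<Longrightarrow> \<sigma> + \<tau> \<in> sos_polys V"
proof -
  have "mat 1 1 (\<lambda>_. \<sigma> + \<tau>) = mat 1 1 (\<lambda>_. \<sigma>) + mat 1 1 (\<lambda>_. \<tau>)"
    by (intro eq_matI) auto
  then show "\<sigma> \<in> sos_polys V \<Longrightarrow> \<tau> \<in> sos_polys V \<Longrightarrow> \<sigma> + \<tau> \<in> sos_polys V"
    using sos_mats_add[of "mat 1 1 (\<lambda>_. \<sigma>)" V 1 "mat 1 1 (\<lambda>_. \<tau>)"] by (simp add: sos_polys_def)
qed

lemma sos_polys_square_mult:
  assumes "p \<in> polys_in V" "\<sigma> \<in> sos_polys V"
  shows "p\<^sup>2 * \<sigma> \<in> sos_polys V"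
proof -
  have "mat 1 1 (\<lambda>_. p\<^sup>2 * \<sigma>) = p\<^sup>2 \<cdot>\<^sub>m mat 1 1 (\<lambda>_. \<sigma>)"
    by (intro eq_matI) auto
  then show ?thesis
    using sos_mats_square_smult[OF assms(1), of "mat 1 1 (\<lambda>_. \<sigma>)" 1] assms(2)
    by (simp add: sos_polys_def)
qed

lemma one_in_sos_polys: "1 \<in> sos_polys V"
proof -
  have "mat 1 1 (\<lambda>(i, j). 1 * 1) \<in> sos_mats V 1"
    by (rule sos_mats_outer_product) (rule poly.one_in)
  then show ?thesis by (simp add: sos_polys_def case_prod_unfold)
qed

lemma sos_polys_in: "\<sigma> \<in> sos_polys V \<Longrightarrow> \<sigma> \<in> polys_in V"
  using sos_mats_in[of "mat 1 1 (\<lambda>_. \<sigma>)" V 1 0 0] by (simp add: sos_polys_def)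

lemma mat_inner_eq:
  assumes "A \<in> carrier_mat r r" "B \<in> carrier_mat r r"
  shows "mat_inner A B = (\<Sum>i<r. \<Sum>k<r. A $$ (k, i) * B $$ (k, i))"
  using assms by (auto simp: mat_inner_def scalar_prod_def lessThan_atLeast0 intro!: sum.cong)

lemma mat_inner_add:
  "A \<in> carrier_mat r r \<Longrightarrow> A' \<in> carrier_mat r r \<Longrightarrow> B \<in> carrier_mat r r \<Longrightarrow>
    mat_inner (A + A') B = mat_inner A B + mat_inner A' B"
  by (simp add: mat_inner_eq[of _ r] distrib_right sum.distrib)

lemma mat_inner_smult:
  "A \<in> carrier_mat r r \<Longrightarrow> B \<in> carrier_mat r r \<Longrightarrow> mat_inner (c \<cdot>\<^sub>m A) B = c * mat_inner A B"
  by (simp add: mat_inner_eq[of _ r] sum_distrib_left mult.assoc)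

lemma mat_inner_zero: "B \<in> carrier_mat r r \<Longrightarrow> mat_inner (0\<^sub>m r r) B = 0"
  by (simp add: mat_inner_eq[of _ r])

lemma mat_inner_in:
  "A \<in> sos_mats V r \<Longrightarrow> B \<in> sym_mats V r \<Longrightarrow> mat_inner A B \<in> polys_in V"
  by (subst mat_inner_eq[of _ r])
    (auto simp: sym_mats_def sos_mats_carrier intro!: polys_in_sum polys_in_mult sos_mats_in[of A V r])

lemma Q1_I:
  assumes "\<sigma> \<in> sos_polys I" "\<And>j. j \<in> J \<Longrightarrow> S j \<in> sos_mats (vars_xy I) (q j)"
    and "a = \<sigma> + (\<Sum>j\<in>J. integral_y Y \<nu> (mat_inner (S j) (G j)))"
  shows "a \<in> Q1 I J q G Y \<nu>"
  unfolding Q1_def using assms by blast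

text \<open>
  A factor \<open>p\<^sup>2\<close> with \<open>p \<in> \<real>[x(I)]\<close> is moved under the integrals, where it turns SOS matrices
  into SOS matrices.
\<close>

lemma Q1_quadratic_module:
  assumes G: "\<And>j. j \<in> J \<Longrightarrow> G j \<in> sym_mats (vars_xy I) (q j)"
  shows "poly.quadratic_module I (Q1 I J q G Y \<nu>)"
  unfolding poly.quadratic_module_def
proof (intro conjI ballI)
  have G_carrier: "G j \<in> carrier_mat (q j) (q j)" if "j \<in> J" for j
    using G[OF that] by (simp add: sym_mats_def)
  have "1 = 1 + (\<Sum>j\<in>J. integral_y Y \<nu> (mat_inner (0\<^sub>m (q j) (q j)) (G j)))"
    using G_carrier by (simp add: mat_inner_zero integral_y_zero)
  then show "1 \<in> Q1 I J q G Y \<nu>"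
    by (rule Q1_I[OF one_in_sos_polys zero_in_sos_mats])
  fix a assume "a \<in> Q1 I J q G Y \<nu>"
  then obtain \<sigma> S where a: "a = \<sigma> + (\<Sum>j\<in>J. integral_y Y \<nu> (mat_inner (S j) (G j)))"
    and \<sigma>: "\<sigma> \<in> sos_polys I" and S: "\<And>j. j \<in> J \<Longrightarrow> S j \<in> sos_mats (vars_xy I) (q j)"
    unfolding Q1_def by blast
  show "a + b \<in> Q1 I J q G Y \<nu>" if b: "b \<in> Q1 I J q G Y \<nu>" for b
  proof -
    from b obtain \<tau> T where b: "b = \<tau> + (\<Sum>j\<in>J. integral_y Y \<nu> (mat_inner (T j) (G j)))"
      and \<tau>: "\<tau> \<in> sos_polys I" and T: "\<And>j. j \<in> J \<Longrightarrow> T j \<in> sos_mats (vars_xy I) (q j)"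
      unfolding Q1_def by blast
    have "mat_inner (S j + T j) (G j) = mat_inner (S j) (G j) + mat_inner (T j) (G j)" if "j \<in> J" for j
      using that by (intro mat_inner_add[of _ "q j"] G_carrier sos_mats_carrier[OF S] sos_mats_carrier[OF T])
    then have eq: "a + b = (\<sigma> + \<tau>) + (\<Sum>j\<in>J. integral_y Y \<nu> (mat_inner (S j + T j) (G j)))"
      by (simp add: a b integral_y_add sum.distrib add_ac)
    show ?thesis
      by (rule Q1_I[OF sos_polys_add[OF \<sigma> \<tau>] _ eq]) (intro sos_mats_add S T)
  qed
  show "p\<^sup>2 * a \<in> Q1 I J q G Y \<nu>" if p: "p \<in> polys_in I" for p
  proof -
    obtain p' where p': "p' \<in> polys_in (vars_xy I)"
      "\<And>h. integral_y Y \<nu> (p' * h) = p * integral_y Y \<nu> h"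
      using integral_y_pull_out[OF p] by blast
    have "integral_y Y \<nu> (mat_inner (p'\<^sup>2 \<cdot>\<^sub>m S j) (G j)) = p\<^sup>2 * integral_y Y \<nu> (mat_inner (S j) (G j))"
      if "j \<in> J" for j
      using that p'(2)
      by (simp add: mat_inner_smult[OF sos_mats_carrier[OF S] G_carrier] power2_eq_square mult.assoc)
    then have eq: "p\<^sup>2 * a = p\<^sup>2 * \<sigma> + (\<Sum>j\<in>J. integral_y Y \<nu> (mat_inner (p'\<^sup>2 \<cdot>\<^sub>m S j) (G j)))"
      by (simp add: a distrib_left sum_distrib_left)
    show ?thesis
      by (rule Q1_I[OF sos_polys_square_mult[OF p \<sigma>] _ eq]) (intro sos_mats_square_smult p'(1) S)
  qed
qed

lemma Q1_in:
  assumes "\<And>j. j \<in> J \<Longrightarrow> G j \<in> sym_mats (vars_xy I) (q j)"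
  shows "Q1 I J q G Y \<nu> \<subseteq> polys_in I"
proof
  fix a assume "a \<in> Q1 I J q G Y \<nu>"
  then obtain \<sigma> S where a: "a = \<sigma> + (\<Sum>j\<in>J. integral_y Y \<nu> (mat_inner (S j) (G j)))"
    and \<sigma>: "\<sigma> \<in> sos_polys I" and S: "\<And>j. j \<in> J \<Longrightarrow> S j \<in> sos_mats (vars_xy I) (q j)"
    unfolding Q1_def by blast
  have "integral_y Y \<nu> (mat_inner (S j) (G j)) \<in> polys_in I" if "j \<in> J" for j
    by (rule integral_y_in[OF mat_inner_in[OF S[OF that] assms[OF that]]])
  then show "a \<in> polys_in I"
    unfolding a by (intro polys_in_add[OF sos_polys_in[OF \<sigma>] polys_in_sum])
qed

lemma integral_y_mat_inner_in_Q1: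
  assumes J: "finite J" "j \<in> J" and G: "\<And>i. i \<in> J \<Longrightarrow> G i \<in> sym_mats (vars_xy I) (q i)"
    and S: "S \<in> sos_mats (vars_xy I) (q j)"
  shows "integral_y Y \<nu> (mat_inner S (G j)) \<in> Q1 I J q G Y \<nu>"
proof (rule Q1_I)
  let ?S = "\<lambda>i. if i = j then S else 0\<^sub>m (q i) (q i)"
  have "mat 1 1 (\<lambda>_. 0) = (0\<^sub>m 1 1 :: 'a rpoly mat)" by (intro eq_matI) auto
  then show "0 \<in> sos_polys I"
    using zero_in_sos_mats[of 1 I] by (simp add: sos_polys_def)
  show "?S i \<in> sos_mats (vars_xy I) (q i)" if "i \<in> J" for i
    using S zero_in_sos_mats by auto
  have "integral_y Y \<nu> (mat_inner (?S i) (G i)) =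
      (if i = j then integral_y Y \<nu> (mat_inner S (G j)) else 0)" if "i \<in> J" for i
    using G[OF that] by (auto simp: sym_mats_def mat_inner_zero integral_y_zero)
  then have "(\<Sum>i\<in>J. integral_y Y \<nu> (mat_inner (?S i) (G i))) =
      (\<Sum>i\<in>J. if i = j then integral_y Y \<nu> (mat_inner S (G j)) else 0)"
    by (rule sum.cong[OF refl])
  then show "integral_y Y \<nu> (mat_inner S (G j)) =
      0 + (\<Sum>i\<in>J. integral_y Y \<nu> (mat_inner (?S i) (G i)))"
    using J by simp
qed

section \<open>Integral constraints and pointwise semidefiniteness\<close>

text \<open>
  By the Lindeloef property countably many open null sets cover the complement.
\<close>

lemma complement_of_support_null:
  fixes \<nu> :: "'a::second_countable_topology measure"
  assumes sets: "sets \<nu> = sets borel"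
  shows "- measure_support \<nu> \<in> null_sets \<nu>"
proof -
  define \<F> where "\<F> = {U. open U \<and> emeasure \<nu> U = 0}"
  obtain \<F>' where \<F>': "\<F>' \<subseteq> \<F>" "countable \<F>'" "\<Union>\<F>' = \<Union>\<F>"
    using Lindelof[of \<F>] by (auto simp: \<F>_def)
  have "\<Union>(id ` \<F>') \<in> null_sets \<nu>"
    using \<F>'(1) by (intro null_sets_UN' \<F>'(2)) (auto simp: \<F>_def sets intro!: null_setsI)
  moreover have "- measure_support \<nu> = \<Union>\<F>"
    by (auto simp: measure_support_def \<F>_def not_gr_zero)
  ultimately show ?thesis using \<F>'(3) by simp
qed

text \<open>
  Approximating \<open>\<phi>\<close> by functions that satisfy \<open>P\<close> extends the inequality to
  \<open>\<integral> \<phi>\<^sup>2 g \<ge> 0\<close> for all continuous \<open>\<phi>\<close>.  If \<open>\<phi>\<close> is the negative part of \<open>g\<close>, the integrand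
  is nonpositive, so it vanishes almost everywhere.  The open set where \<open>g\<close> is negative is then
  null and cannot meet the support.
\<close>

lemma nonneg_on_support:
  fixes \<nu> :: "(real ^ 'm::finite) measure" and P :: "(real ^ 'm \<Rightarrow> real) \<Rightarrow> bool"
  assumes Y: "compact Y" and sets: "sets \<nu> = sets borel" and supp: "measure_support \<nu> = Y"
    and one: "set_integrable \<nu> Y (\<lambda>y. 1 :: real)"
    and g: "continuous_on UNIV g"
    and P: "\<And>p. P p \<Longrightarrow> continuous_on UNIV p"
    and dense: "\<And>\<phi> e. continuous_on Y \<phi> \<Longrightarrow> 0 < e \<Longrightarrow> \<exists>p. P p \<and> (\<forall>y\<in>Y. \<bar>\<phi> y - p y\<bar> < e)"
    and nonneg: "\<And>p. P p \<Longrightarrow> 0 \<le> set_lebesgue_integral \<nu> Y (\<lambda>y. (p y)\<^sup>2 * g y)"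
    and y: "y \<in> Y"
  shows "0 \<le> g y"
proof -
  (* With this weight the integrand phi^2 g is - phi^3, so it has a sign, and it vanishes only
     where g is nonnegative. *)
  define \<phi> where "\<phi> y = max 0 (- g y)" for y
  have \<phi>: "continuous_on UNIV \<phi>" unfolding \<phi>_def by (intro continuous_intros g)
  have Y_sets: "Y \<in> sets borel" using Y by (simp add: borel_compact)
  have meas: "(\<lambda>y. indicator Y y *\<^sub>R f y) \<in> borel_measurable \<nu>" if "continuous_on UNIV f" for f :: "real ^ 'm \<Rightarrow> real"
    unfolding measurable_cong_sets[OF sets refl]
    by (intro borel_measurable_scaleR borel_measurable_indicator Y_sets borel_measurable_continuous_onI that)
  have "\<exists>p. P p \<and> (\<forall>y\<in>Y. \<bar>\<phi> y - p y\<bar> < 1 / (real n + 1))" for n :: nat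
    by (rule dense) (auto intro: continuous_on_subset[OF \<phi>])
  then obtain p where p: "\<And>n. P (p n)" and approx: "\<And>n y. y \<in> Y \<Longrightarrow> \<bar>\<phi> y - p n y\<bar> < 1 / (real n + 1)"
    by metis
  have "bounded (g ` Y)"
    by (intro compact_imp_bounded compact_continuous_image Y continuous_on_subset[OF g]) auto
  then obtain B where B: "0 < B" "\<And>y. y \<in> Y \<Longrightarrow> \<bar>g y\<bar> \<le> B"
    unfolding bounded_pos by auto
  have \<phi>_le: "\<bar>\<phi> y\<bar> \<le> B" if "y \<in> Y" for y using B(2)[OF that] B(1) by (auto simp: \<phi>_def)
  let ?w = "\<lambda>y. indicator Y y *\<^sub>R ((B + 1)\<^sup>2 * B)"
  let ?s = "\<lambda>n y. indicator Y y *\<^sub>R ((p n y)\<^sup>2 * g y)"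
  let ?f = "\<lambda>y. indicator Y y *\<^sub>R ((\<phi> y)\<^sup>2 * g y)"
  have w: "integrable \<nu> ?w"
    using integrable_mult_left[OF one[unfolded set_integrable_def], of "(B + 1)\<^sup>2 * B"] by simp
  have s: "?s n \<in> borel_measurable \<nu>" for n by (intro meas continuous_intros g P p)
  have f: "?f \<in> borel_measurable \<nu>" by (intro meas continuous_intros g \<phi>)
  have lim: "AE y in \<nu>. (\<lambda>n. ?s n y) \<longlonglongrightarrow> ?f y"
  proof (rule AE_I2)
    fix y
    show "(\<lambda>n. ?s n y) \<longlonglongrightarrow> ?f y"
    proof (cases "y \<in> Y")
      case True
      have "(\<lambda>n. p n y - \<phi> y) \<longlonglongrightarrow> 0"
      proof (rule Lim_null_comparison)
        show "\<forall>\<^sub>F n in sequentially. norm (p n y - \<phi> y) \<le> inverse (real (Suc n))"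
          using less_imp_le[OF approx[OF True]]
          by (intro always_eventually allI) (simp add: abs_minus_commute inverse_eq_divide add.commute)
      qed (rule LIMSEQ_inverse_real_of_nat)
      then have "(\<lambda>n. p n y) \<longlonglongrightarrow> \<phi> y" by (rule LIM_zero_cancel)
      then show ?thesis by (intro tendsto_intros)
    qed simp
  qed
  have bound: "AE y in \<nu>. norm (?s n y) \<le> ?w y" for n
  proof (rule AE_I2)
    fix y
    show "norm (?s n y) \<le> ?w y"
    proof (cases "y \<in> Y")
      case True
      have "1 / (real n + 1) \<le> 1" by simp
      then have "\<bar>p n y\<bar> \<le> B + 1" using approx[OF True, of n] \<phi>_le[OF True] by linarith
      then have "(p n y)\<^sup>2 \<le> (B + 1)\<^sup>2" by (metis abs_ge_zero power2_abs power_mono)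
      then show ?thesis using B True by (auto simp: abs_mult intro!: mult_mono)
    qed simp
  qed
  have "(\<lambda>n. integral\<^sup>L \<nu> (?s n)) \<longlonglongrightarrow> integral\<^sup>L \<nu> ?f"
    by (rule integral_dominated_convergence[OF f s w lim bound])
  then have ge: "0 \<le> integral\<^sup>L \<nu> ?f"
    using nonneg[OF p] unfolding set_lebesgue_integral_def by (intro LIMSEQ_le_const) auto
  have int: "integrable \<nu> ?f"
    by (rule integrable_dominated_convergence[OF f s w lim bound])
  have f_le: "?f y \<le> 0" for y by (auto simp: indicator_def \<phi>_def max_def mult_nonneg_nonpos)
  then have "0 \<le> integral\<^sup>L \<nu> (\<lambda>y. - ?f y)" by (intro Bochner_Integration.integral_nonneg) simp
  then have "integral\<^sup>L \<nu> (\<lambda>y. - ?f y) = 0" using ge by simp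
  moreover have "integrable \<nu> (\<lambda>y. - ?f y)"
    by (rule Bochner_Integration.integrable_minus[OF int])
  ultimately have "AE y in \<nu>. - ?f y = 0"
    using f_le integral_nonneg_eq_0_iff_AE[of \<nu> "\<lambda>y. - ?f y"] by simp
  moreover have "AE y in \<nu>. y \<in> Y"
    using AE_not_in[OF complement_of_support_null[OF sets]] by (simp add: supp)
  ultimately have AE: "AE y in \<nu>. 0 \<le> g y"
    by eventually_elim (auto simp: \<phi>_def max_def split: if_splits)
  show ?thesis
  proof (rule ccontr)
    assume "\<not> 0 \<le> g y"
    define U where "U = {y. g y < 0}"
    have "open U" unfolding U_def by (intro open_Collect_less g continuous_on_const)
    moreover have "y \<in> U" using \<open>\<not> 0 \<le> g y\<close> by (simp add: U_def)
    ultimately have "0 < emeasure \<nu> U" using y unfolding supp[symmetric] measure_support_def by blast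
    moreover have "U \<in> sets \<nu>" using \<open>open U\<close> by (simp add: sets)
    then have "U \<in> null_sets \<nu>"
      using AE by (subst AE_iff_null_sets) (auto simp: U_def not_less)
    ultimately show False by auto
  qed
qed

text \<open>
  The multipliers \<open>p\<^sup>2 v v\<^sup>T\<close> reduce the claim to the scalar function \<open>v\<^sup>T G(x, y) v\<close> of \<open>y\<close>.
  For fixed \<open>x\<close> the polynomials \<open>p\<close> in \<open>(x, y)\<close> restrict to a dense set of functions on \<open>Y\<close>.
\<close>

lemma psd_of_nonneg_integrals:
  fixes Y :: "(real ^ 'm::finite) set" and x :: "real ^ 'n::finite"
  assumes Y: "compact Y" and sets: "sets \<nu> = sets borel" and supp: "measure_support \<nu> = Y"
    and fin: "\<And>h :: 'm rpoly. (\<integral>\<^sup>+y\<in>Y. ennreal \<bar>eval (vec_nth y) h\<bar> \<partial>\<nu>) < \<infinity>"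
    and G: "G \<in> sym_mats (vars_xy I) r"
    and nonneg: "\<And>S. S \<in> sos_mats (vars_xy I) r \<Longrightarrow>
      0 \<le> eval (vec_nth x) (integral_y Y \<nu> (mat_inner S G))"
    and y: "y \<in> Y"
  shows "psd (map_mat (eval_xy x y) G)"
proof -
  have G_carrier: "G \<in> carrier_mat r r" and "transpose_mat G = G"
    using G by (auto simp: sym_mats_def)
  have eval_xy_simps: "eval_xy x y (p * q) = eval_xy x y p * eval_xy x y q"
    "eval_xy x y (p + q) = eval_xy x y p + eval_xy x y q"
    "eval_xy x y (Const a) = a" "eval_xy x y (\<Sum>i\<in>K. u i) = (\<Sum>i\<in>K. eval_xy x y (u i))"
    for y :: "real ^ 'm" and p q a and K :: "nat set" and u
    by (simp_all add: eval_xy_def eval_simps)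
  have cont: "continuous_on S (\<lambda>y. eval_xy x y p)" for p and S :: "(real ^ 'm) set"
    unfolding eval_xy_def
  proof (rule continuous_on_eval)
    show "continuous_on S (\<lambda>y. case_sum (vec_nth x) (vec_nth y) v)" for v
      by (cases v) (auto intro!: continuous_intros)
  qed
  have monom: "set_integrable \<nu> Y (\<lambda>y. eval_monom (vec_nth y) \<beta>)" for \<beta>
    by (rule set_integrable_monom[OF Y sets fin])
  have "0 \<le> scalar_prod v (mult_mat_vec (map_mat (eval_xy x y) G) v)" if v: "v \<in> carrier_vec r" for v
  proof -
    define g where "g y = (\<Sum>i<r. \<Sum>k<r. vec_index v i * vec_index v k * eval_xy x y (G $$ (k, i)))" for y
    let ?P = "\<lambda>f. \<exists>p\<in>polys_in (vars_xy I). f = (\<lambda>y :: real ^ 'm. eval_xy x y p)"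
    have "0 \<le> g y"
    proof (rule nonneg_on_support[OF Y sets supp, where P = ?P])
      show "set_integrable \<nu> Y (\<lambda>y. 1 :: real)" using monom[of 0] by (simp add: eval_monom_def)
      show "continuous_on UNIV g" unfolding g_def by (intro continuous_intros cont)
      show "continuous_on UNIV f" if "?P f" for f using that cont by auto
      show "\<exists>f. ?P f \<and> (\<forall>y\<in>Y. \<bar>\<phi> y - f y\<bar> < e)" if "continuous_on Y \<phi>" "0 < e" for \<phi> and e :: real
      proof (rule Stone_Weierstrass_HOL[OF Y _ _ _ _ _ that])
        show "?P (\<lambda>x. a)" for a
          by (rule bexI[of _ "Const a"]) (auto simp: polys_in_Const eval_xy_simps)
        show "continuous_on Y f" if "?P f" for f using that cont by auto
        show "?P (\<lambda>x. f x + h x)" if "?P f \<and> ?P h" for f h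
        proof -
          from that obtain p q where "p \<in> polys_in (vars_xy I)" "q \<in> polys_in (vars_xy I)"
            "f = (\<lambda>y. eval_xy x y p)" "h = (\<lambda>y. eval_xy x y q)" by blast
          then show ?thesis by (intro bexI[of _ "p + q"]) (auto simp: eval_xy_simps polys_in_add)
        qed
        show "?P (\<lambda>x. f x * h x)" if "?P f \<and> ?P h" for f h
        proof -
          from that obtain p q where "p \<in> polys_in (vars_xy I)" "q \<in> polys_in (vars_xy I)"
            "f = (\<lambda>y. eval_xy x y p)" "h = (\<lambda>y. eval_xy x y q)" by blast
          then show ?thesis by (intro bexI[of _ "p * q"]) (auto simp: eval_xy_simps polys_in_mult)
        qed
        show "\<exists>f. ?P f \<and> f a \<noteq> f b" if ab: "a \<in> Y \<and> b \<in> Y \<and> a \<noteq> b" for a b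
        proof -
          from ab obtain j where "vec_nth a j \<noteq> vec_nth b j"
            by (auto simp: Finite_Cartesian_Product.vec_eq_iff)
          moreover have "Var (Inr j) \<in> polys_in (vars_xy I)"
            by (rule polys_in_Var) (simp add: vars_xy_def)
          ultimately show ?thesis
            by (intro exI[of _ "\<lambda>y. eval_xy x y (Var (Inr j))"] conjI bexI[of _ "Var (Inr j)"] refl)
              (auto simp: eval_xy_def)
        qed
      qed
      show "0 \<le> set_lebesgue_integral \<nu> Y (\<lambda>y. (f y)\<^sup>2 * g y)" if "?P f" for f
      proof -
        from that obtain p where p: "p \<in> polys_in (vars_xy I)" and f: "f = (\<lambda>y. eval_xy x y p)" by blast
        (* S is the square p^2 times the rank one matrix v v^T *)
        define u where "u i = p * Const (vec_index v i)" for i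
        define S where "S = mat r r (\<lambda>(i, j). u i * u j)"
        have S: "S \<in> sos_mats (vars_xy I) r"
          unfolding S_def using p
          by (intro sos_mats_outer_product) (auto simp: u_def intro: polys_in_mult polys_in_Const)
        have "eval_xy x y (mat_inner S G) = (f y)\<^sup>2 * g y" for y
          unfolding mat_inner_eq[OF sos_mats_carrier[OF S] G_carrier] g_def
          by (simp add: S_def u_def f eval_xy_simps sum_distrib_left power2_eq_square algebra_simps)
        then show ?thesis using nonneg[OF S] by (simp add: eval_integral_y[OF monom])
      qed
    qed (rule y)
    also have "g y = scalar_prod v (mult_mat_vec (map_mat (eval_xy x y) G) v)"
    proof -
      have "g y = (\<Sum>i<r. vec_index v i * (\<Sum>k<r. eval_xy x y (G $$ (i, k)) * vec_index v k))"
        unfolding g_def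
        by (subst sum.swap) (simp add: sum_distrib_left algebra_simps)
      also have "\<dots> = scalar_prod v (mult_mat_vec (map_mat (eval_xy x y) G) v)"
        using G_carrier v
        by (auto simp: scalar_prod_def lessThan_atLeast0 intro!: sum.cong)
      finally show ?thesis .
    qed
    finally show ?thesis .
  qed
  moreover have "transpose_mat (map_mat (eval_xy x y) G) = map_mat (eval_xy x y) G"
    using \<open>transpose_mat G = G\<close> by (simp only: map_mat_transpose)
  ultimately show ?thesis using G_carrier by (auto simp: psd_def)
qed

section \<open>The sparse Positivstellensatz with integrated constraints\<close>

theorem theoremB:
  fixes Y :: "(real ^ 'm::finite) set"
    and \<nu> :: "(real ^ 'm) measure"
    and f :: "'n::finite rpoly"
    and s t :: nat
    and q :: "nat \<Rightarrow> nat"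
    and G :: "nat \<Rightarrow> ('n + 'm) rpoly mat"
    and I :: "nat \<Rightarrow> 'n set"
    and J :: "nat \<Rightarrow> nat set"
    and F :: "nat \<Rightarrow> 'n rpoly"
  assumes "compact Y"
    and "sets \<nu> = sets borel"
    and "measure_support \<nu> = Y"
    and "\<And>h :: 'm rpoly. (\<integral>\<^sup>+y\<in>Y. ennreal \<bar>eval (vec_nth y) h\<bar> \<partial>\<nu>) < \<infinity>"
    and "\<And>j. j \<in> {1..s} \<Longrightarrow> G j \<in> sym_mats UNIV (q j)"
    and "\<And>l. l \<in> {1..t} \<Longrightarrow> J l \<subseteq> {1..s}"
    and "(\<Union>l\<in>{1..t}. I l) = UNIV"
    and "(\<Union>l\<in>{1..t}. J l) = {1..s}"
    and running_intersection:
      "\<And>l. l \<in> {2..t} \<Longrightarrow> \<exists>k\<in>{1..<l}. I l \<inter> (\<Union>j\<in>{1..<l}. I j) \<subseteq> I k"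
    and "\<And>l j. l \<in> {1..t} \<Longrightarrow> j \<in> J l \<Longrightarrow> G j \<in> sym_mats (vars_xy (I l)) (q j)"
    and "f = (\<Sum>l\<in>{1..t}. F l)"
    and "\<And>l. l \<in> {1..t} \<Longrightarrow> F l \<in> polys_in (I l)"
    and "\<And>l. l \<in> {1..t} \<Longrightarrow>
      \<exists>C>0. Const C - (\<Sum>i\<in>I l. Var i ^ 2) \<in> Q1 (I l) (J l) q G Y \<nu>"
    and "\<And>x. x \<in> feasible_set s G Y \<Longrightarrow> eval (vec_nth x) f > 0"
  shows "f \<in> (\<Sum>l\<in>{1..t}. Q1 (I l) (J l) q G Y \<nu>) \<and>
    (\<exists>\<sigma> S.
      (\<forall>l\<in>{1..t}. \<sigma> l \<in> sos_polys (I l)) \<and>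
      (\<forall>l\<in>{1..t}. \<forall>j\<in>J l. S l j \<in> sos_mats (vars_xy (I l)) (q j)) \<and>
      f = (\<Sum>l\<in>{1..t}. \<sigma> l + (\<Sum>j\<in>J l. integral_y Y \<nu> (mat_inner (S l j) (G j)))))"
proof -
  note Y = assms(1) and sets = assms(2) and supp = assms(3) and fin = assms(4) and J_sub = assms(6)
    and J_Union = assms(8) and G = assms(10) and f = assms(11) and F = assms(12)
    and arch = assms(13) and pos = assms(14)
  have "\<exists>m. (\<forall>l\<in>{1..t}. m l \<in> Q1 (I l) (J l) q G Y \<nu>) \<and> (\<Sum>l\<in>{1..t}. F l) = (\<Sum>l\<in>{1..t}. m l)"
  proof (rule sparse_putinar[where I = I])
    fix l assume l: "l \<in> {1..t}"
    show "poly.quadratic_module (I l) (Q1 (I l) (J l) q G Y \<nu>)"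
      by (rule Q1_quadratic_module[OF G[OF l]])
    show "Q1 (I l) (J l) q G Y \<nu> \<subseteq> polys_in (I l)"
      by (rule Q1_in[OF G[OF l]])
    show "\<exists>C. Const C - (\<Sum>i\<in>I l. Var i ^ 2) \<in> Q1 (I l) (J l) q G Y \<nu>"
      using arch[OF l] by blast
  next
    fix x :: "real ^ 'n"
    assume nonneg: "\<And>l m. l \<in> {1..t} \<Longrightarrow> m \<in> Q1 (I l) (J l) q G Y \<nu> \<Longrightarrow> 0 \<le> eval (vec_nth x) m"
    have "psd (map_mat (eval_xy x y) (G j))" if j: "j \<in> {1..s}" and y: "y \<in> Y" for j y
    proof -
      obtain l where l: "l \<in> {1..t}" "j \<in> J l" using j J_Union by blast
      show ?thesis
      proof (rule psd_of_nonneg_integrals[OF Y sets supp fin G[OF l] _ y])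
        fix S :: "('n + 'm) rpoly mat" assume S: "S \<in> sos_mats (vars_xy (I l)) (q j)"
        have "integral_y Y \<nu> (mat_inner S (G j)) \<in> Q1 (I l) (J l) q G Y \<nu>"
          by (rule integral_y_mat_inner_in_Q1[where G = G and q = q and j = j, OF _ l(2) G[OF l(1)] S])
            (rule finite_subset[OF J_sub[OF l(1)]], simp)
        then show "0 \<le> eval (vec_nth x) (integral_y Y \<nu> (mat_inner S (G j)))"
          by (rule nonneg[OF l(1)])
      qed
    qed
    then have "x \<in> feasible_set s G Y" by (simp add: feasible_set_def)
    then show "0 < eval (vec_nth x) (\<Sum>l\<in>{1..t}. F l)"
      using pos f by simp
  qed (use running_intersection F in auto)
  then obtain m where m: "\<And>l. l \<in> {1..t} \<Longrightarrow> m l \<in> Q1 (I l) (J l) q G Y \<nu>"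
    and F_eq: "(\<Sum>l\<in>{1..t}. F l) = (\<Sum>l\<in>{1..t}. m l)"
    by blast
  have f_eq: "f = (\<Sum>l\<in>{1..t}. m l)" unfolding f by (rule F_eq)
  have "f \<in> (\<Sum>l\<in>{1..t}. Q1 (I l) (J l) q G Y \<nu>)"
    unfolding set_sum_alt[OF finite_atLeastAtMost] using m f_eq by blast
  moreover obtain \<sigma> S where \<sigma>S: "\<forall>l\<in>{1..t}. \<sigma> l \<in> sos_polys (I l) \<and>
      (\<forall>j\<in>J l. S l j \<in> sos_mats (vars_xy (I l)) (q j)) \<and>
      m l = \<sigma> l + (\<Sum>j\<in>J l. integral_y Y \<nu> (mat_inner (S l j) (G j)))"
  proof -
    have "\<forall>l\<in>{1..t}. \<exists>\<sigma> S. \<sigma> \<in> sos_polys (I l) \<and> (\<forall>j\<in>J l. S j \<in> sos_mats (vars_xy (I l)) (q j)) \<and>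
        m l = \<sigma> + (\<Sum>j\<in>J l. integral_y Y \<nu> (mat_inner (S j) (G j)))"
      using m unfolding Q1_def by blast
    from bchoice[OF this] obtain \<sigma> where "\<forall>l\<in>{1..t}. \<exists>S. \<sigma> l \<in> sos_polys (I l) \<and>
        (\<forall>j\<in>J l. S j \<in> sos_mats (vars_xy (I l)) (q j)) \<and>
        m l = \<sigma> l + (\<Sum>j\<in>J l. integral_y Y \<nu> (mat_inner (S j) (G j)))" ..
    from bchoice[OF this] show ?thesis using that by blast
  qed
  moreover have "f = (\<Sum>l\<in>{1..t}. \<sigma> l + (\<Sum>j\<in>J l. integral_y Y \<nu> (mat_inner (S l j) (G j))))"
    unfolding f_eq by (intro sum.cong refl) (use \<sigma>S in blast)
  ultimately show ?thesis using \<sigma>S by (intro conjI exI[of _ \<sigma>] exI[of _ S]) auto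
qed

end
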